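(* Let $\mathsf N$ be a noetherian form on a category $\mathcal C$, with set-sized fibre lattices $\Lambda_X$, transports $f_!\dashv f^*$, and induced factorization system $(\mathcal E,\mathcal M)$. Define $H:\mathcal C\to\mathbf{Ab}$ by $$H(X)=\mathbb Z^{(\Lambda_X)},\qquad H(f)[S]=[f_!S]\quad(f:X\to Y,\ S\in\Lambda_X),$$ where $\mathbb Z^{(\Lambda_X)}$ is the free abelian group with basis the underlying set of $\Lambda_X$. Then the form $\mathsf N^{\mathrm{mod}}$ with fibres and transports $$\mathsf N^{\mathrm{mod}}(X)=\operatorname{Sub}(HX),\qquad f^{\mathrm{mod}}_!(A)=H(f)(A),\qquad (f^{\mathrm{mod}})^*(B)=H(f)^{-1}(B)$$ for subgroups $A\le HX$ and $B\le HY$ is noetherian and induces precisely $(\mathcal E,\mathcal M)$. Every fibre of $\mathsf N^{\mathrm{mod}}$ is a complete algebraic modular lattice.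
   Context: $\operatorname{Sub}(A)$ is the lattice of subgroups of an abelian group $A$. A complete lattice is algebraic when each element is a join of compact elements, where $c$ is compact when $c\le\bigvee\mathcal S$ implies $c\le\bigvee\mathcal S_0$ for some finite $\mathcal S_0\subseteq\mathcal S$. Conventions: categories are locally small; "set" is relative to a fixed universe. A proper factorization system $(\mathcal E,\mathcal M)$ is an orthogonal factorization system with every morphism in $\mathcal E$ an epimorphism and every morphism in $\mathcal M$ a monomorphism. Forms. An (orean) form $\mathsf F$ on a category $\mathcal C$ assigns to each object $X$ a set-sized bounded lattice $\mathsf F(X)$ (the fibre over $X$; its elements are called clusters) and to each morphism $f:X\to Y$ monotone maps (transports) $f_!:\mathsf F(X)\to\mathsf F(Y)$ and $f^*:\mathsf F(Y)\to\mathsf F(X)$ with $f_!S\le T\iff S\le f^*T$, such that $(gf)_!=g_!f_!$, $(gf)^*=f^*g^*$, and identities act as identities. Put $\operatorname{Im}f=f_!\top_X$ and $\operatorname{Ker}f=f^*\bot_Y$. A cluster in $\mathsf F(X)$ is conormal if it is the image of some morphism of $\mathcal C$ with codomain $X$, and normal if it is the kernel of some morphism of $\mathcal C$ with domain $X$. An embedding of a conormal $S\in\mathsf F(X)$ is a morphism $\iota$ into $X$ with $\operatorname{Im}\iota=S$ such that every morphism $f$ into $X$ with $\operatorname{Im}f\le S$ factors as $f=\iota h$ for a unique $h$. A quotient of a normal $K\in\mathsf F(X)$ is a morphism $\pi$ out of $X$ with $\operatorname{Ker}\pi=K$ such that every morphism $g$ out of $X$ with $K\le\operatorname{Ker}g$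 factors as $g=h\pi$ for a unique $h$. The form is noetherian if: (N1) $f^*f_!S=S\vee\operatorname{Ker}f$ and $f_!f^*T=T\wedge\operatorname{Im}f$ for all $f,S,T$; (N2) every morphism $f$ factors as $f=me$ with $e$ a quotient of $\operatorname{Ker}f$ and $m$ an embedding of $\operatorname{Im}f$; (N3) the join of two normal clusters (in the same fibre) is normal, and the meet of two conormal clusters is conormal. For a noetherian form, the class $\mathcal E$ of all quotients (of normal clusters) and the class $\mathcal M$ of all embeddings (of conormal clusters) form a proper factorization system, the one induced by the form. *)

theory Defs
  imports "HOL-Algebra.Free_Abelian_Groups"
begin

section \<open>Categories and factorization systems\<close>

text \<open>Objects and arrows form sets in arbitrary types. Operations are only meaningful on
  objects, arrows and composable pairs; \<open>Comp C g f\<close> is \<open>g\<close> after \<open>f\<close>.\<close>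

record ('o, 'm) cat =
  Ob :: "'o set"
  Ar :: "'m set"
  Dom :: "'m \<Rightarrow> 'o"
  Cod :: "'m \<Rightarrow> 'o"
  Id :: "'o \<Rightarrow> 'm"
  Comp :: "'m \<Rightarrow> 'm \<Rightarrow> 'm"

definition Hom :: "('o, 'm) cat \<Rightarrow> 'o \<Rightarrow> 'o \<Rightarrow> 'm set" where
  "Hom C X Y = {f \<in> Ar C. Dom C f = X \<and> Cod C f = Y}"

locale category =
  fixes C :: "('o, 'm) cat"
  assumes Dom_Ob: "f \<in> Ar C \<Longrightarrow> Dom C f \<in> Ob C"
    and Cod_Ob: "f \<in> Ar C \<Longrightarrow> Cod C f \<in> Ob C"
    and Id_Hom: "X \<in> Ob C \<Longrightarrow> Id C X \<in> Hom C X X"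
    and Comp_Hom: "f \<in> Hom C X Y \<Longrightarrow> g \<in> Hom C Y Z \<Longrightarrow> Comp C g f \<in> Hom C X Z"
    and Comp_Id: "f \<in> Hom C X Y \<Longrightarrow> Comp C f (Id C X) = f"
    and Id_Comp: "f \<in> Hom C X Y \<Longrightarrow> Comp C (Id C Y) f = f"
    and Comp_assoc: "f \<in> Hom C W X \<Longrightarrow> g \<in> Hom C X Y \<Longrightarrow> h \<in> Hom C Y Z \<Longrightarrow>
      Comp C h (Comp C g f) = Comp C (Comp C h g) f"

definition epic :: "('o, 'm) cat \<Rightarrow> 'm \<Rightarrow> bool" where
  "epic C e \<longleftrightarrow> e \<in> Ar C \<and>
    (\<forall>Z. \<forall>g \<in> Hom C (Cod C e) Z. \<forall>h \<in> Hom C (Cod C e) Z. Comp C g e = Comp C h e \<longrightarrow> g = h)"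

definition monic :: "('o, 'm) cat \<Rightarrow> 'm \<Rightarrow> bool" where
  "monic C m \<longleftrightarrow> m \<in> Ar C \<and>
    (\<forall>W. \<forall>g \<in> Hom C W (Dom C m). \<forall>h \<in> Hom C W (Dom C m). Comp C m g = Comp C m h \<longrightarrow> g = h)"

definition orthogonal :: "('o, 'm) cat \<Rightarrow> 'm \<Rightarrow> 'm \<Rightarrow> bool" where
  "orthogonal C e m \<longleftrightarrow>
    (\<forall>u \<in> Hom C (Dom C e) (Dom C m). \<forall>v \<in> Hom C (Cod C e) (Cod C m).
      Comp C v e = Comp C m u \<longrightarrow>
      (\<exists>!d. d \<in> Hom C (Cod C e) (Dom C m) \<and> Comp C d e = u \<and> Comp C m d = v))"

definition orthogonal_factorization_system ::
    "('o, 'm) cat \<Rightarrow> 'm set \<Rightarrow> 'm set \<Rightarrow> bool" where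
  "orthogonal_factorization_system C E M \<longleftrightarrow>
    E = {e \<in> Ar C. \<forall>m \<in> M. orthogonal C e m} \<and>
    M = {m \<in> Ar C. \<forall>e \<in> E. orthogonal C e m} \<and>
    (\<forall>f \<in> Ar C. \<exists>e \<in> E. \<exists>m \<in> M. Dom C m = Cod C e \<and> f = Comp C m e)"

definition proper_factorization_system ::
    "('o, 'm) cat \<Rightarrow> 'm set \<Rightarrow> 'm set \<Rightarrow> bool" where
  "proper_factorization_system C E M \<longleftrightarrow>
    orthogonal_factorization_system C E M \<and> (\<forall>e \<in> E. epic C e) \<and> (\<forall>m \<in> M. monic C m)"


section \<open>Forms\<close>

text \<open>\<open>push F f\<close> is the transport \<open>f\<^sub>!\<close>, \<open>pull F f\<close> is \<open>f\<^sup>*\<close>. All fibres are carved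
  out of one type by their carriers.\<close>

record ('o, 'm, 'l) form_data =
  fibre :: "'o \<Rightarrow> 'l gorder"
  push :: "'m \<Rightarrow> 'l \<Rightarrow> 'l"
  pull :: "'m \<Rightarrow> 'l \<Rightarrow> 'l"

locale orean_form = category C for C :: "('o, 'm) cat" +
  fixes F :: "('o, 'm, 'l) form_data"
  assumes fibre_bounded_lattice: "X \<in> Ob C \<Longrightarrow> bounded_lattice (fibre F X)"
    and push_closed: "f \<in> Hom C X Y \<Longrightarrow> push F f \<in> carrier (fibre F X) \<rightarrow> carrier (fibre F Y)"
    and pull_closed: "f \<in> Hom C X Y \<Longrightarrow> pull F f \<in> carrier (fibre F Y) \<rightarrow> carrier (fibre F X)"
    and push_isotone: "f \<in> Hom C X Y \<Longrightarrow> isotone (fibre F X) (fibre F Y) (push F f)"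
    and pull_isotone: "f \<in> Hom C X Y \<Longrightarrow> isotone (fibre F Y) (fibre F X) (pull F f)"
    and push_pull: "f \<in> Hom C X Y \<Longrightarrow> S \<in> carrier (fibre F X) \<Longrightarrow> T \<in> carrier (fibre F Y) \<Longrightarrow>
      push F f S \<sqsubseteq>\<^bsub>fibre F Y\<^esub> T \<longleftrightarrow> S \<sqsubseteq>\<^bsub>fibre F X\<^esub> pull F f T"
    and push_Comp: "f \<in> Hom C X Y \<Longrightarrow> g \<in> Hom C Y Z \<Longrightarrow> S \<in> carrier (fibre F X) \<Longrightarrow>
      push F (Comp C g f) S = push F g (push F f S)"
    and pull_Comp: "f \<in> Hom C X Y \<Longrightarrow> g \<in> Hom C Y Z \<Longrightarrow> T \<in> carrier (fibre F Z) \<Longrightarrow>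
      pull F (Comp C g f) T = pull F f (pull F g T)"
    and push_Id: "X \<in> Ob C \<Longrightarrow> S \<in> carrier (fibre F X) \<Longrightarrow> push F (Id C X) S = S"
    and pull_Id: "X \<in> Ob C \<Longrightarrow> S \<in> carrier (fibre F X) \<Longrightarrow> pull F (Id C X) S = S"

definition Im_cluster :: "('o, 'm) cat \<Rightarrow> ('o, 'm, 'l) form_data \<Rightarrow> 'm \<Rightarrow> 'l" where
  "Im_cluster C F f = push F f \<top>\<^bsub>fibre F (Dom C f)\<^esub>"

definition Ker_cluster :: "('o, 'm) cat \<Rightarrow> ('o, 'm, 'l) form_data \<Rightarrow> 'm \<Rightarrow> 'l" where
  "Ker_cluster C F f = pull F f \<bottom>\<^bsub>fibre F (Cod C f)\<^esub>"

definition conormal_cluster ::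
    "('o, 'm) cat \<Rightarrow> ('o, 'm, 'l) form_data \<Rightarrow> 'o \<Rightarrow> 'l \<Rightarrow> bool" where
  "conormal_cluster C F X S \<longleftrightarrow>
    S \<in> carrier (fibre F X) \<and> (\<exists>f \<in> Ar C. Cod C f = X \<and> Im_cluster C F f = S)"

definition normal_cluster ::
    "('o, 'm) cat \<Rightarrow> ('o, 'm, 'l) form_data \<Rightarrow> 'o \<Rightarrow> 'l \<Rightarrow> bool" where
  "normal_cluster C F X K \<longleftrightarrow>
    K \<in> carrier (fibre F X) \<and> (\<exists>f \<in> Ar C. Dom C f = X \<and> Ker_cluster C F f = K)"

definition embedding_of ::
    "('o, 'm) cat \<Rightarrow> ('o, 'm, 'l) form_data \<Rightarrow> 'o \<Rightarrow> 'l \<Rightarrow> 'm \<Rightarrow> bool" where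
  "embedding_of C F X S \<iota> \<longleftrightarrow>
    conormal_cluster C F X S \<and> \<iota> \<in> Ar C \<and> Cod C \<iota> = X \<and> Im_cluster C F \<iota> = S \<and>
    (\<forall>f \<in> Ar C. Cod C f = X \<and> Im_cluster C F f \<sqsubseteq>\<^bsub>fibre F X\<^esub> S \<longrightarrow>
      (\<exists>!h. h \<in> Hom C (Dom C f) (Dom C \<iota>) \<and> f = Comp C \<iota> h))"

definition quotient_of ::
    "('o, 'm) cat \<Rightarrow> ('o, 'm, 'l) form_data \<Rightarrow> 'o \<Rightarrow> 'l \<Rightarrow> 'm \<Rightarrow> bool" where
  "quotient_of C F X K p \<longleftrightarrow>
    normal_cluster C F X K \<and> p \<in> Ar C \<and> Dom C p = X \<and> Ker_cluster C F p = K \<and>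
    (\<forall>g \<in> Ar C. Dom C g = X \<and> K \<sqsubseteq>\<^bsub>fibre F X\<^esub> Ker_cluster C F g \<longrightarrow>
      (\<exists>!h. h \<in> Hom C (Cod C p) (Cod C g) \<and> g = Comp C h p))"

locale noetherian_form = orean_form C F
  for C :: "('o, 'm) cat" and F :: "('o, 'm, 'l) form_data" +
  assumes pull_push: "f \<in> Hom C X Y \<Longrightarrow> S \<in> carrier (fibre F X) \<Longrightarrow>
      pull F f (push F f S) = S \<squnion>\<^bsub>fibre F X\<^esub> Ker_cluster C F f"
    and push_pull_meet: "f \<in> Hom C X Y \<Longrightarrow> T \<in> carrier (fibre F Y) \<Longrightarrow>
      push F f (pull F f T) = T \<sqinter>\<^bsub>fibre F Y\<^esub> Im_cluster C F f"
    and factorization: "f \<in> Hom C X Y \<Longrightarrow>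
      \<exists>e m. quotient_of C F X (Ker_cluster C F f) e \<and> embedding_of C F Y (Im_cluster C F f) m \<and>
        Cod C e = Dom C m \<and> f = Comp C m e"
    and join_normal: "X \<in> Ob C \<Longrightarrow> normal_cluster C F X K \<Longrightarrow> normal_cluster C F X L \<Longrightarrow>
      normal_cluster C F X (K \<squnion>\<^bsub>fibre F X\<^esub> L)"
    and meet_conormal: "X \<in> Ob C \<Longrightarrow> conormal_cluster C F X S \<Longrightarrow> conormal_cluster C F X T \<Longrightarrow>
      conormal_cluster C F X (S \<sqinter>\<^bsub>fibre F X\<^esub> T)"

definition quotients :: "('o, 'm) cat \<Rightarrow> ('o, 'm, 'l) form_data \<Rightarrow> 'm set" where
  "quotients C F = {p. \<exists>X \<in> Ob C. \<exists>K. quotient_of C F X K p}"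

definition embeddings :: "('o, 'm) cat \<Rightarrow> ('o, 'm, 'l) form_data \<Rightarrow> 'm set" where
  "embeddings C F = {i. \<exists>X \<in> Ob C. \<exists>S. embedding_of C F X S i}"

definition induces_factorization_system ::
    "('o, 'm) cat \<Rightarrow> ('o, 'm, 'l) form_data \<Rightarrow> 'm set \<Rightarrow> 'm set \<Rightarrow> bool" where
  "induces_factorization_system C F E M \<longleftrightarrow>
    proper_factorization_system C E M \<and> quotients C F = E \<and> embeddings C F = M"


section \<open>Algebraic and modular lattices\<close>

definition compact_element :: "'a gorder \<Rightarrow> 'a \<Rightarrow> bool" where
  "compact_element L c \<longleftrightarrow> c \<in> carrier L \<and>
    (\<forall>A \<subseteq> carrier L. c \<sqsubseteq>\<^bsub>L\<^esub> \<Squnion>\<^bsub>L\<^esub>A \<longrightarrow> (\<exists>B \<subseteq> A. finite B \<and> c \<sqsubseteq>\<^bsub>L\<^esub> \<Squnion>\<^bsub>L\<^esub>B))"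

definition algebraic_lattice :: "'a gorder \<Rightarrow> bool" where
  "algebraic_lattice L \<longleftrightarrow> complete_lattice L \<and>
    (\<forall>x \<in> carrier L. \<exists>A. (\<forall>c \<in> A. compact_element L c) \<and> x = \<Squnion>\<^bsub>L\<^esub>A)"

definition modular_lattice :: "'a gorder \<Rightarrow> bool" where
  "modular_lattice L \<longleftrightarrow> lattice L \<and>
    (\<forall>a \<in> carrier L. \<forall>b \<in> carrier L. \<forall>c \<in> carrier L.
      a \<sqsubseteq>\<^bsub>L\<^esub> c \<longrightarrow> a \<squnion>\<^bsub>L\<^esub> (b \<sqinter>\<^bsub>L\<^esub> c) = (a \<squnion>\<^bsub>L\<^esub> b) \<sqinter>\<^bsub>L\<^esub> c)"


section \<open>The form of subgroups of free abelian groups on the fibres\<close>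

definition Sub :: "'a monoid \<Rightarrow> 'a set gorder" where
  "Sub G = \<lparr>carrier = {A. subgroup A G}, eq = (=), le = (\<subseteq>)\<rparr>"

locale Ab_functor = category C for C :: "('o, 'm) cat" +
  fixes G :: "'o \<Rightarrow> 'a monoid" and h :: "'m \<Rightarrow> 'a \<Rightarrow> 'a"
  assumes comm_group_ob: "X \<in> Ob C \<Longrightarrow> comm_group (G X)"
    and hom_ar: "f \<in> Hom C X Y \<Longrightarrow> h f \<in> hom (G X) (G Y)"
    and map_Id: "X \<in> Ob C \<Longrightarrow> x \<in> carrier (G X) \<Longrightarrow> h (Id C X) x = x"
    and map_Comp: "f \<in> Hom C X Y \<Longrightarrow> g \<in> Hom C Y Z \<Longrightarrow> x \<in> carrier (G X) \<Longrightarrow>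
      h (Comp C g f) x = h g (h f x)"

definition H_ob :: "('o, 'm, 'l) form_data \<Rightarrow> 'o \<Rightarrow> ('l \<Rightarrow>\<^sub>0 int) monoid" where
  "H_ob N X = free_Abelian_group (carrier (fibre N X))"

definition H_map :: "('o, 'm, 'l) form_data \<Rightarrow> 'm \<Rightarrow> ('l \<Rightarrow>\<^sub>0 int) \<Rightarrow> ('l \<Rightarrow>\<^sub>0 int)" where
  "H_map N f = frag_extend (\<lambda>S. frag_of (push N f S))"

lemma H_map_frag_of: "H_map N f (frag_of S) = frag_of (push N f S)"
  by (simp add: H_map_def)

definition mod_form ::
    "('o, 'm) cat \<Rightarrow> ('o, 'm, 'l) form_data \<Rightarrow> ('o, 'm, ('l \<Rightarrow>\<^sub>0 int) set) form_data" where
  "mod_form C N =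
    \<lparr>fibre = (\<lambda>X. Sub (H_ob N X)),
     push = (\<lambda>f A. H_map N f ` A),
     pull = (\<lambda>f B. {x \<in> carrier (H_ob N (Dom C f)). H_map N f x \<in> B})\<rparr>"

end

theory Submission
  imports Defs
begin

text \<open>
  Applied to a difference of basis elements, \<open>H(f)([S] - [T]) = 0\<close> says \<open>f\<^sub>!S = f\<^sub>!T\<close>, and by
  (N1) the kernel of \<open>H(f)\<close> is generated by the elements \<open>[S] - [S \<squnion> Ker f]\<close>, while the image of
  \<open>H(f)\<close> is freely generated by the clusters below \<open>Im f\<close>. Hence inclusions between kernels
  (images) of the form of subgroups correspond exactly to inclusions between kernels (images) of
  the original form. The universal properties defining quotients and embeddings only
  refer to these inclusions, so both forms have the same quotients and embeddings. The join
  axiom follows from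
  \<open>[S] - [S \<squnion> K \<squnion> L] = ([S] - [S \<squnion> K]) + ([S \<squnion> K] - [S \<squnion> K \<squnion> L])\<close>.
\<close>

section \<open>Quotients and embeddings in a form\<close>

lemma (in category) Ar_Hom: "f \<in> Ar C \<Longrightarrow> f \<in> Hom C (Dom C f) (Cod C f)"
  by (simp add: Hom_def)

section \<open>Fibre order, and kernels and images of composites\<close>

context orean_form
begin

lemma push_in: "f \<in> Hom C X Y \<Longrightarrow> S \<in> carrier (fibre F X) \<Longrightarrow> push F f S \<in> carrier (fibre F Y)"
  using push_closed by blast

lemma pull_in: "f \<in> Hom C X Y \<Longrightarrow> T \<in> carrier (fibre F Y) \<Longrightarrow> pull F f T \<in> carrier (fibre F X)"
  using pull_closed by blast

lemma Hom_Ob: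
  assumes "f \<in> Hom C X Y"
  shows "X \<in> Ob C" "Y \<in> Ob C"
  using assms Dom_Ob Cod_Ob by (auto simp: Hom_def)

lemma fibre_bounds:
  assumes "X \<in> Ob C"
  shows top_in: "\<top>\<^bsub>fibre F X\<^esub> \<in> carrier (fibre F X)"
    and bottom_in: "\<bottom>\<^bsub>fibre F X\<^esub> \<in> carrier (fibre F X)"
    and le_top: "S \<in> carrier (fibre F X) \<Longrightarrow> S \<sqsubseteq>\<^bsub>fibre F X\<^esub> \<top>\<^bsub>fibre F X\<^esub>"
    and bottom_le: "S \<in> carrier (fibre F X) \<Longrightarrow> \<bottom>\<^bsub>fibre F X\<^esub> \<sqsubseteq>\<^bsub>fibre F X\<^esub> S"
proof -
  interpret L: bounded_lattice "fibre F X" by (rule fibre_bounded_lattice[OF assms])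
  show "\<top>\<^bsub>fibre F X\<^esub> \<in> carrier (fibre F X)" "\<bottom>\<^bsub>fibre F X\<^esub> \<in> carrier (fibre F X)"
    by auto
  show "S \<in> carrier (fibre F X) \<Longrightarrow> S \<sqsubseteq>\<^bsub>fibre F X\<^esub> \<top>\<^bsub>fibre F X\<^esub>"
       "S \<in> carrier (fibre F X) \<Longrightarrow> \<bottom>\<^bsub>fibre F X\<^esub> \<sqsubseteq>\<^bsub>fibre F X\<^esub> S"
    by (simp_all add: L.top_higher L.bottom_lower)
qed

lemma fibre_refl: "X \<in> Ob C \<Longrightarrow> S \<in> carrier (fibre F X) \<Longrightarrow> S \<sqsubseteq>\<^bsub>fibre F X\<^esub> S"
  by (meson bounded_lattice.axioms(1) fibre_bounded_lattice lattice.axioms(1)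
      partial_order.axioms(1) upper_semilattice.axioms(1) weak_partial_order.le_refl)

lemma fibre_antisym:
  assumes "X \<in> Ob C" "S \<in> carrier (fibre F X)" "T \<in> carrier (fibre F X)"
    and "S \<sqsubseteq>\<^bsub>fibre F X\<^esub> T" "T \<sqsubseteq>\<^bsub>fibre F X\<^esub> S"
  shows "S = T"
proof -
  interpret L: bounded_lattice "fibre F X" by (rule fibre_bounded_lattice[OF assms(1)])
  show ?thesis using assms by (intro L.le_antisym) auto
qed

lemma Ker_eq: "f \<in> Hom C X Y \<Longrightarrow> Ker_cluster C F f = pull F f \<bottom>\<^bsub>fibre F Y\<^esub>"
  by (simp add: Hom_def Ker_cluster_def)

lemma Im_eq: "f \<in> Hom C X Y \<Longrightarrow> Im_cluster C F f = push F f \<top>\<^bsub>fibre F X\<^esub>"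
  by (simp add: Hom_def Im_cluster_def)

lemma Ker_in: "f \<in> Hom C X Y \<Longrightarrow> Ker_cluster C F f \<in> carrier (fibre F X)"
  by (simp add: Ker_eq pull_in bottom_in Hom_Ob)

lemma Im_in: "f \<in> Hom C X Y \<Longrightarrow> Im_cluster C F f \<in> carrier (fibre F Y)"
  by (simp add: Im_eq push_in top_in Hom_Ob)

lemma Ker_Id: "X \<in> Ob C \<Longrightarrow> Ker_cluster C F (Id C X) = \<bottom>\<^bsub>fibre F X\<^esub>"
  using Ker_eq[OF Id_Hom] pull_Id bottom_in by simp

lemma Ker_Comp:
  "f \<in> Hom C X Y \<Longrightarrow> g \<in> Hom C Y Z \<Longrightarrow> Ker_cluster C F (Comp C g f) = pull F f (Ker_cluster C F g)"
  by (simp add: Ker_eq[OF Comp_Hom] Ker_eq[of g] pull_Comp bottom_in Hom_Ob)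

lemma Im_Comp:
  "f \<in> Hom C X Y \<Longrightarrow> g \<in> Hom C Y Z \<Longrightarrow> Im_cluster C F (Comp C g f) = push F g (Im_cluster C F f)"
  by (simp add: Im_eq[OF Comp_Hom] Im_eq[of f] push_Comp top_in Hom_Ob)

lemma Ker_le_Ker_Comp:
  assumes "f \<in> Hom C X Y" "g \<in> Hom C Y Z"
  shows "Ker_cluster C F f \<sqsubseteq>\<^bsub>fibre F X\<^esub> Ker_cluster C F (Comp C g f)"
  unfolding Ker_Comp[OF assms] Ker_eq[OF assms(1)]
  using pull_isotone[OF assms(1)] bottom_le bottom_in Ker_in[OF assms(2)] Hom_Ob[OF assms(1)]
  by (auto simp: isotone_def)

lemma Im_Comp_le_Im:
  assumes "f \<in> Hom C X Y" "g \<in> Hom C Y Z"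
  shows "Im_cluster C F (Comp C g f) \<sqsubseteq>\<^bsub>fibre F Z\<^esub> Im_cluster C F g"
  unfolding Im_Comp[OF assms] Im_eq[OF assms(2)]
  using push_isotone[OF assms(2)] le_top top_in Im_in[OF assms(1)] Hom_Ob[OF assms(1)]
  by (auto simp: isotone_def)

section \<open>Universal properties of quotients and embeddings\<close>

lemma quotient_of_iff:
  "quotient_of C F X K p \<longleftrightarrow> p \<in> quotients C F \<and> Dom C p = X \<and> Ker_cluster C F p = K"
  using Dom_Ob by (auto simp: quotients_def quotient_of_def)

lemma embedding_of_iff:
  "embedding_of C F X S i \<longleftrightarrow> i \<in> embeddings C F \<and> Cod C i = X \<and> Im_cluster C F i = S"
  using Cod_Ob by (auto simp: embeddings_def embedding_of_def)

lemma quotients_Ar: "p \<in> quotients C F \<Longrightarrow> p \<in> Ar C"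
  by (auto simp: quotients_def quotient_of_def)

lemma embeddings_Ar: "i \<in> embeddings C F \<Longrightarrow> i \<in> Ar C"
  by (auto simp: embeddings_def embedding_of_def)

text \<open>Normality of the kernel is automatic, since every arrow witnesses the normality of its
  own kernel. What remains is a universal property that sees the fibres only through inclusions
  between kernels.\<close>

lemma quotients_eq:
  "quotients C F = {p \<in> Ar C. \<forall>g \<in> Ar C. Dom C g = Dom C p \<and>
     Ker_cluster C F p \<sqsubseteq>\<^bsub>fibre F (Dom C p)\<^esub> Ker_cluster C F g \<longrightarrow>
     (\<exists>!h. h \<in> Hom C (Cod C p) (Cod C g) \<and> g = Comp C h p)}" (is "_ = ?R")
proof (intro Set.set_eqI iffI)
  fix p assume p: "p \<in> ?R"
  then have "normal_cluster C F (Dom C p) (Ker_cluster C F p)"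
    using Ker_in[OF Ar_Hom] by (auto simp: normal_cluster_def)
  then have "quotient_of C F (Dom C p) (Ker_cluster C F p) p"
    using p by (auto simp: quotient_of_def)
  then show "p \<in> quotients C F" using quotient_of_iff by blast
qed (auto simp: quotients_def quotient_of_def)

lemma embeddings_eq:
  "embeddings C F = {i \<in> Ar C. \<forall>f \<in> Ar C. Cod C f = Cod C i \<and>
     Im_cluster C F f \<sqsubseteq>\<^bsub>fibre F (Cod C i)\<^esub> Im_cluster C F i \<longrightarrow>
     (\<exists>!h. h \<in> Hom C (Dom C f) (Dom C i) \<and> f = Comp C i h)}" (is "_ = ?R")
proof (intro Set.set_eqI iffI)
  fix i assume i: "i \<in> ?R"
  then have "conormal_cluster C F (Cod C i) (Im_cluster C F i)"
    using Im_in[OF Ar_Hom] by (auto simp: conormal_cluster_def)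
  then have "embedding_of C F (Cod C i) (Im_cluster C F i) i"
    using i by (auto simp: embedding_of_def)
  then show "i \<in> embeddings C F" using embedding_of_iff by blast
qed (auto simp: embeddings_def embedding_of_def)

text \<open>The form suited to comparing two forms on \<open>C\<close>: if kernels of arrows out of
  a common object are ordered alike in both, the quotients coincide.\<close>

lemma quotient_iff:
  assumes p: "p \<in> Hom C X Y"
  shows "p \<in> quotients C F \<longleftrightarrow> (\<forall>Z. \<forall>g \<in> Hom C X Z.
    Ker_cluster C F p \<sqsubseteq>\<^bsub>fibre F X\<^esub> Ker_cluster C F g \<longrightarrow> (\<exists>!h. h \<in> Hom C Y Z \<and> g = Comp C h p))"
    (is "_ = ?R")
proof -
  have d: "p \<in> Ar C" "Dom C p = X" "Cod C p = Y" using p by (simp_all add: Hom_def)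
  have "?R \<longleftrightarrow> (\<forall>g \<in> Ar C. Dom C g = X \<and>
     Ker_cluster C F p \<sqsubseteq>\<^bsub>fibre F X\<^esub> Ker_cluster C F g \<longrightarrow>
     (\<exists>!h. h \<in> Hom C Y (Cod C g) \<and> g = Comp C h p))"
    unfolding Hom_def[of C X] by blast
  then show ?thesis by (simp add: quotients_eq d)
qed

lemma embedding_iff:
  assumes i: "i \<in> Hom C Y Z"
  shows "i \<in> embeddings C F \<longleftrightarrow> (\<forall>X. \<forall>f \<in> Hom C X Z.
    Im_cluster C F f \<sqsubseteq>\<^bsub>fibre F Z\<^esub> Im_cluster C F i \<longrightarrow> (\<exists>!h. h \<in> Hom C X Y \<and> f = Comp C i h))"
    (is "_ = ?R")
proof -
  have d: "i \<in> Ar C" "Dom C i = Y" "Cod C i = Z" using i by (simp_all add: Hom_def)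
  have "?R \<longleftrightarrow> (\<forall>f \<in> Ar C. Cod C f = Z \<and>
     Im_cluster C F f \<sqsubseteq>\<^bsub>fibre F Z\<^esub> Im_cluster C F i \<longrightarrow>
     (\<exists>!h. h \<in> Hom C (Dom C f) Y \<and> f = Comp C i h))"
    unfolding Hom_def[of C _ Z] by blast
  then show ?thesis by (simp add: embeddings_eq d)
qed

lemma quotient_lift:
  assumes "p \<in> quotients C F" "p \<in> Hom C X Y" "g \<in> Hom C X Z"
    and "Ker_cluster C F p \<sqsubseteq>\<^bsub>fibre F X\<^esub> Ker_cluster C F g"
  obtains h where "h \<in> Hom C Y Z" "g = Comp C h p"
  using assms quotient_iff by blast

lemma embedding_lift:
  assumes "i \<in> embeddings C F" "i \<in> Hom C Y Z" "f \<in> Hom C X Z"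
    and "Im_cluster C F f \<sqsubseteq>\<^bsub>fibre F Z\<^esub> Im_cluster C F i"
  obtains h where "h \<in> Hom C X Y" "f = Comp C i h"
  using assms embedding_iff by blast

text \<open>The composite \<open>Comp C g p\<close> satisfies the kernel condition by
  \<open>Ker_le_Ker_Comp\<close>, so uniqueness in the universal property of \<open>p\<close>,
  applied to this composite, is exactly cancellation.\<close>

lemma quotient_epic:
  assumes "p \<in> quotients C F"
  shows "epic C p"
  unfolding epic_def
proof (intro conjI allI ballI impI)
  show p: "p \<in> Ar C" using assms by (rule quotients_Ar)
  fix Z g h assume gh: "g \<in> Hom C (Cod C p) Z" "h \<in> Hom C (Cod C p) Z" "Comp C g p = Comp C h p"
  then have gp: "Comp C g p \<in> Hom C (Dom C p) Z" using Comp_Hom Ar_Hom p by blast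
  then have "\<exists>!k. k \<in> Hom C (Cod C p) Z \<and> Comp C g p = Comp C k p"
    using assms Ker_le_Ker_Comp[OF Ar_Hom[OF p] gh(1)] quotient_iff[OF Ar_Hom[OF p]] by blast
  then show "g = h" using gh by metis
qed

lemma embedding_monic:
  assumes "i \<in> embeddings C F"
  shows "monic C i"
  unfolding monic_def
proof (intro conjI allI ballI impI)
  show i: "i \<in> Ar C" using assms by (rule embeddings_Ar)
  fix W g h assume gh: "g \<in> Hom C W (Dom C i)" "h \<in> Hom C W (Dom C i)" "Comp C i g = Comp C i h"
  then have gp: "Comp C i g \<in> Hom C W (Cod C i)" using Comp_Hom Ar_Hom i by blast
  then have "\<exists>!k. k \<in> Hom C W (Dom C i) \<and> Comp C i g = Comp C i k"
    using assms Im_Comp_le_Im[OF gh(1) Ar_Hom[OF i]] embedding_iff[OF Ar_Hom[OF i]] by blast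
  then show "g = h" using gh by metis
qed

lemma epic_cancel:
  "epic C e \<Longrightarrow> e \<in> Hom C X Y \<Longrightarrow> g \<in> Hom C Y Z \<Longrightarrow> h \<in> Hom C Y Z \<Longrightarrow> Comp C g e = Comp C h e \<Longrightarrow> g = h"
  by (auto simp: epic_def Hom_def)

lemma monic_cancel:
  "monic C m \<Longrightarrow> m \<in> Hom C X Y \<Longrightarrow> g \<in> Hom C W X \<Longrightarrow> h \<in> Hom C W X \<Longrightarrow> Comp C m g = Comp C m h \<Longrightarrow> g = h"
  by (auto simp: monic_def Hom_def)

text \<open>Orthogonality pins down an arrow only up to an isomorphism, here \<open>m\<close> with
  inverse \<open>d\<close>; closure under such isomorphisms is what turns this into membership in
  the class.\<close>

lemma quotient_iso_Comp:
  assumes p: "p \<in> quotients C F" "p \<in> Hom C X Y" and m: "m \<in> Hom C Y Z" and d: "d \<in> Hom C Z Y"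
    and dm: "Comp C d m = Id C Y" and md: "Comp C m d = Id C Z"
  shows "Comp C m p \<in> quotients C F"
proof -
  let ?q = "Comp C m p"
  have q: "?q \<in> Hom C X Z" using Comp_Hom p m by blast
  have dq: "Comp C d ?q = p"
    using Comp_assoc[OF p(2) m d] dm Id_Comp p by metis
  have "\<exists>!h. h \<in> Hom C Z W \<and> g = Comp C h ?q"
    if g: "g \<in> Hom C X W" and le: "Ker_cluster C F ?q \<sqsubseteq>\<^bsub>fibre F X\<^esub> Ker_cluster C F g" for g W
  proof -
    \<comment> \<open>\<open>p\<close> and \<open>?q\<close> each arise from the other by
      postcomposition (\<open>?q = m p\<close>, \<open>p = d ?q\<close>), so each kernel lies below
      the other.\<close>
    have "Ker_cluster C F p = Ker_cluster C F ?q"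
      using fibre_antisym[OF _ Ker_in[OF p(2)] Ker_in[OF q] Ker_le_Ker_Comp[OF p(2) m]]
        Ker_le_Ker_Comp[OF q d] Hom_Ob q dq by metis
    then obtain k where k: "k \<in> Hom C Y W" "g = Comp C k p"
      using quotient_lift[OF p g] le by metis
    have eq: "Comp C k d \<in> Hom C Z W" "g = Comp C (Comp C k d) ?q"
      using k d q dq Comp_Hom Comp_assoc[OF q d k(1)] by metis+
    moreover have "h = h'" if h: "h \<in> Hom C Z W" "h' \<in> Hom C Z W" "Comp C h ?q = Comp C h' ?q" for h h'
    proof -
      have "Comp C (Comp C h m) p = Comp C (Comp C h' m) p"
        using Comp_assoc[OF p(2) m h(1)] Comp_assoc[OF p(2) m h(2)] h(3) by simp
      then have "Comp C h m = Comp C h' m"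
        using epic_cancel[OF quotient_epic[OF p(1)] p(2)] Comp_Hom m h by blast
      then have "Comp C h (Comp C m d) = Comp C h' (Comp C m d)"
        using Comp_assoc[OF d m h(1)] Comp_assoc[OF d m h(2)] by simp
      then show ?thesis using md h Comp_Id by metis
    qed
    ultimately show ?thesis by metis
  qed
  then show ?thesis using quotient_iff[OF q] by simp
qed

lemma embedding_Comp_iso:
  assumes i: "i \<in> embeddings C F" "i \<in> Hom C Y X" and e: "e \<in> Hom C Z Y" and d: "d \<in> Hom C Y Z"
    and de: "Comp C d e = Id C Z" and ed: "Comp C e d = Id C Y"
  shows "Comp C i e \<in> embeddings C F"
proof -
  let ?j = "Comp C i e"
  have j: "?j \<in> Hom C Z X" using Comp_Hom i e by blast
  have jd: "Comp C ?j d = i"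
    using Comp_assoc[OF d e i(2)] ed Comp_Id i by metis
  have "\<exists>!h. h \<in> Hom C W Z \<and> f = Comp C ?j h"
    if f: "f \<in> Hom C W X" and le: "Im_cluster C F f \<sqsubseteq>\<^bsub>fibre F X\<^esub> Im_cluster C F ?j" for f W
  proof -
    \<comment> \<open>Dually, \<open>i\<close> and \<open>?j\<close> factor through each other, so
      their images agree.\<close>
    have "Im_cluster C F ?j = Im_cluster C F i"
      using fibre_antisym[OF _ Im_in[OF j] Im_in[OF i(2)] Im_Comp_le_Im[OF e i(2)]]
        Im_Comp_le_Im[OF d j] Hom_Ob j jd by metis
    then obtain k where k: "k \<in> Hom C W Y" "f = Comp C i k"
      using embedding_lift[OF i f] le by metis
    have eq: "Comp C d k \<in> Hom C W Z" "f = Comp C ?j (Comp C d k)"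
      using k d j jd Comp_Hom Comp_assoc[OF k(1) d j] by metis+
    moreover have "h = h'" if h: "h \<in> Hom C W Z" "h' \<in> Hom C W Z" "Comp C ?j h = Comp C ?j h'" for h h'
    proof -
      have "Comp C i (Comp C e h) = Comp C i (Comp C e h')"
        using Comp_assoc[OF h(1) e i(2)] Comp_assoc[OF h(2) e i(2)] h(3) by simp
      then have "Comp C e h = Comp C e h'"
        using monic_cancel[OF embedding_monic[OF i(1)] i(2)] Comp_Hom e h by blast
      then have "Comp C (Comp C d e) h = Comp C (Comp C d e) h'"
        using Comp_assoc[OF h(1) e d] Comp_assoc[OF h(2) e d] by simp
      then show ?thesis using de h Id_Comp by metis
    qed
    ultimately show ?thesis by metis
  qed
  then show ?thesis using embedding_iff[OF j] by simp
qed

end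

section \<open>The proper factorization system of a noetherian form\<close>

context noetherian_form
begin

lemma quotient_embedding_factorization:
  assumes "f \<in> Hom C X Y"
  obtains Z e m where "e \<in> quotients C F" "m \<in> embeddings C F" "e \<in> Hom C X Z" "m \<in> Hom C Z Y"
    "f = Comp C m e" "Ker_cluster C F e = Ker_cluster C F f" "Im_cluster C F m = Im_cluster C F f"
proof -
  obtain e m where em: "quotient_of C F X (Ker_cluster C F f) e"
    "embedding_of C F Y (Im_cluster C F f) m" "Cod C e = Dom C m" "f = Comp C m e"
    using factorization[OF assms] by blast
  then have "e \<in> Hom C X (Dom C m)" "m \<in> Hom C (Dom C m) Y"
    by (auto simp: quotient_of_def embedding_of_def Hom_def)
  then show thesis
    using that[of e m "Dom C m"] em by (auto simp: quotient_of_iff embedding_of_iff)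
qed

text \<open>The factorization \<open>i = m e\<close> has \<open>Im i = Im m\<close>, so \<open>m\<close> factors through \<open>i\<close>; cancelling
  the mono \<open>i\<close> exhibits \<open>e\<close> as a split mono with the same kernel as \<open>i\<close>.\<close>

lemma Ker_embedding:
  assumes i: "i \<in> embeddings C F" "i \<in> Hom C X Y"
  shows "Ker_cluster C F i = \<bottom>\<^bsub>fibre F X\<^esub>"
proof -
  obtain Z e m where "e \<in> quotients C F" and em: "m \<in> embeddings C F" "e \<in> Hom C X Z" "m \<in> Hom C Z Y"
    "i = Comp C m e" "Ker_cluster C F e = Ker_cluster C F i" "Im_cluster C F m = Im_cluster C F i"
    by (rule quotient_embedding_factorization[OF i(2)])
  have X: "X \<in> Ob C" "Y \<in> Ob C" using Hom_Ob i by auto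
  obtain k where k: "k \<in> Hom C Z X" "m = Comp C i k"
    using fibre_refl[OF X(2) Im_in[OF i(2)]] em(6) by (auto intro: embedding_lift[OF i em(3)])
  have "Comp C i (Comp C k e) = Comp C i (Id C X)"
    using Comp_assoc[OF em(2) k(1) i(2)] Comp_Id[OF i(2)] unfolding k(2)[symmetric] em(4)[symmetric]
    by (rule trans[OF _ sym])
  then have "Comp C k e = Id C X"
    using monic_cancel[OF embedding_monic[OF i(1)] i(2)] Comp_Hom[OF em(2) k(1)] Id_Hom X by blast
  then have "Ker_cluster C F e \<sqsubseteq>\<^bsub>fibre F X\<^esub> \<bottom>\<^bsub>fibre F X\<^esub>"
    using Ker_le_Ker_Comp[OF em(2) k(1)] Ker_Id[OF X(1)] by simp
  then have "Ker_cluster C F e = \<bottom>\<^bsub>fibre F X\<^esub>"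
    using Ker_in[OF em(2)] X by (intro fibre_antisym) (auto simp: bottom_in bottom_le)
  then show ?thesis
    using em(5) by simp
qed

text \<open>Since \<open>m\<close> has bottom kernel, \<open>m u\<close> and \<open>u\<close> have
  the same kernel. Hence \<open>Ker e\<close> \<le> \<open>Ker (v e)\<close> = \<open>Ker u\<close>,
  and \<open>u\<close> descends along the quotient \<open>e\<close>. The other triangle and
  uniqueness follow because \<open>e\<close> is epic.\<close>

lemma quotient_embedding_orthogonal:
  assumes e: "e \<in> quotients C F" and m: "m \<in> embeddings C F"
  shows "orthogonal C e m"
  unfolding orthogonal_def
proof (intro ballI impI)
  fix u v assume u: "u \<in> Hom C (Dom C e) (Dom C m)" and v: "v \<in> Hom C (Cod C e) (Cod C m)"
    and eq: "Comp C v e = Comp C m u"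
  have e': "e \<in> Hom C (Dom C e) (Cod C e)" and m': "m \<in> Hom C (Dom C m) (Cod C m)"
    using Ar_Hom quotients_Ar[OF e] embeddings_Ar[OF m] by blast+
  have "Ker_cluster C F (Comp C m u) = Ker_cluster C F u"
    using Ker_Comp[OF u m'] Ker_embedding[OF m m'] Ker_eq[OF u] by simp
  then have "Ker_cluster C F e \<sqsubseteq>\<^bsub>fibre F (Dom C e)\<^esub> Ker_cluster C F u"
    using Ker_le_Ker_Comp[OF e' v] eq by simp
  then obtain d where d: "d \<in> Hom C (Cod C e) (Dom C m)" "u = Comp C d e"
    using quotient_lift[OF e e' u] by metis
  have "Comp C (Comp C m d) e = Comp C v e"
    using Comp_assoc[OF e' d(1) m'] d eq by simp
  then have "Comp C m d = v"
    using epic_cancel[OF quotient_epic[OF e] e'] Comp_Hom[OF d(1) m'] v by blast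
  then show "\<exists>!d. d \<in> Hom C (Cod C e) (Dom C m) \<and> Comp C d e = u \<and> Comp C m d = v"
    using d epic_cancel[OF quotient_epic[OF e] e'] by (metis (no_types, lifting))
qed

lemma orthogonal_fill:
  assumes "orthogonal C e m" "e \<in> Hom C A B" "m \<in> Hom C X Y" "u \<in> Hom C A X" "v \<in> Hom C B Y"
    and "Comp C v e = Comp C m u"
  obtains d where "d \<in> Hom C B X" "Comp C d e = u" "Comp C m d = v"
proof -
  have "Dom C e = A" "Cod C e = B" "Dom C m = X" "Cod C m = Y"
    using assms by (simp_all add: Hom_def)
  then show thesis
    using assms that unfolding orthogonal_def by blast
qed

text \<open>Factor \<open>f = m e\<close>. The diagonal \<open>d\<close> of the square with sides
  \<open>f\<close> and \<open>m\<close> is a right inverse of the monomorphism \<open>m\<close>, so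
  \<open>m\<close> is invertible and \<open>f\<close> is a quotient followed by an
  isomorphism.\<close>

lemma orthogonal_embeddings_quotient:
  assumes f: "f \<in> Ar C" and orth: "\<forall>m \<in> embeddings C F. orthogonal C f m"
  shows "f \<in> quotients C F"
proof -
  let ?X = "Dom C f" and ?Y = "Cod C f"
  have f': "f \<in> Hom C ?X ?Y" using Ar_Hom f by blast
  obtain Z e m where em: "e \<in> quotients C F" "m \<in> embeddings C F" "e \<in> Hom C ?X Z"
    "m \<in> Hom C Z ?Y" "f = Comp C m e"
    by (rule quotient_embedding_factorization[OF f'])
  have Y: "?Y \<in> Ob C" and Z: "Z \<in> Ob C" using Hom_Ob f' em(4) by blast+
  have "Comp C (Id C ?Y) f = Comp C m e" using em(5) Id_Comp[OF f'] by simp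
  then obtain d where d: "d \<in> Hom C ?Y Z" "Comp C m d = Id C ?Y"
    by (rule orthogonal_fill[OF bspec[OF orth em(2)] f' em(4,3) Id_Hom[OF Y]])
  have "Comp C m (Comp C d m) = Comp C m (Id C Z)"
    using Comp_assoc[OF em(4) d(1) em(4)] d(2) Id_Comp[OF em(4)] Comp_Id[OF em(4)] by simp
  then have "Comp C d m = Id C Z"
    by (rule monic_cancel[OF embedding_monic[OF em(2)] em(4) Comp_Hom[OF em(4) d(1)] Id_Hom[OF Z]])
  from quotient_iso_Comp[OF em(1,3,4) d(1) this d(2)] em(5) show ?thesis by simp
qed

text \<open>Dually, the diagonal \<open>d\<close> is a left inverse of the epimorphism
  \<open>e\<close>, so \<open>e\<close> is invertible and \<open>f\<close> is an isomorphism
  followed by an embedding.\<close>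

lemma orthogonal_quotients_embedding:
  assumes f: "f \<in> Ar C" and orth: "\<forall>e \<in> quotients C F. orthogonal C e f"
  shows "f \<in> embeddings C F"
proof -
  let ?X = "Dom C f" and ?Y = "Cod C f"
  have f': "f \<in> Hom C ?X ?Y" using Ar_Hom f by blast
  obtain Z e m where em: "e \<in> quotients C F" "m \<in> embeddings C F" "e \<in> Hom C ?X Z"
    "m \<in> Hom C Z ?Y" "f = Comp C m e"
    by (rule quotient_embedding_factorization[OF f'])
  have X: "?X \<in> Ob C" and Z: "Z \<in> Ob C" using Hom_Ob f' em(4) by blast+
  have "Comp C m e = Comp C f (Id C ?X)" using em(5) Comp_Id[OF f'] by simp
  then obtain d where d: "d \<in> Hom C Z ?X" "Comp C d e = Id C ?X"
    by (rule orthogonal_fill[OF bspec[OF orth em(1)] em(3) f' Id_Hom[OF X] em(4)])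
  have "Comp C (Comp C e d) e = Comp C (Id C Z) e"
    using Comp_assoc[OF em(3) d(1) em(3)] d(2) Id_Comp[OF em(3)] Comp_Id[OF em(3)] by simp
  then have "Comp C e d = Id C Z"
    by (rule epic_cancel[OF quotient_epic[OF em(1)] em(3) Comp_Hom[OF d(1) em(3)] Id_Hom[OF Z]])
  from embedding_Comp_iso[OF em(2,4,3) d(1) d(2) this] em(5) show ?thesis by simp
qed

theorem proper_factorization_system: "proper_factorization_system C (quotients C F) (embeddings C F)"
  unfolding proper_factorization_system_def orthogonal_factorization_system_def
proof (intro conjI ballI)
  show "quotients C F = {e \<in> Ar C. \<forall>m \<in> embeddings C F. orthogonal C e m}"
    using quotient_embedding_orthogonal orthogonal_embeddings_quotient quotients_Ar by blast
  show "embeddings C F = {m \<in> Ar C. \<forall>e \<in> quotients C F. orthogonal C e m}"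
    using quotient_embedding_orthogonal orthogonal_quotients_embedding embeddings_Ar by blast
  fix f assume "f \<in> Ar C"
  then obtain Z e m where "e \<in> quotients C F" "m \<in> embeddings C F" "e \<in> Hom C (Dom C f) Z"
    "m \<in> Hom C Z (Cod C f)" "f = Comp C m e"
    by (rule quotient_embedding_factorization[OF Ar_Hom])
  then show "\<exists>e \<in> quotients C F. \<exists>m \<in> embeddings C F. Dom C m = Cod C e \<and> f = Comp C m e"
    by (auto simp: Hom_def)
qed (simp_all add: quotient_epic embedding_monic)

end

section \<open>Lattices of subgroups\<close>

lemma carrier_Sub [simp]: "carrier (Sub G) = {A. subgroup A G}"
  and le_Sub [simp]: "le (Sub G) = (\<subseteq>)"
  by (simp_all add: Sub_def)

section \<open>Subgroups of a group: a complete algebraic lattice\<close>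

context
  fixes G :: "'a monoid" (structure)
  assumes G: "group G"
begin

interpretation group G by (rule G)

lemma complete_lattice_Sub: "complete_lattice (Sub G)"
  unfolding Sub_def by (rule subgroups_complete_lattice)

lemma bounded_lattice_Sub: "bounded_lattice (Sub G)"
proof -
  interpret L: complete_lattice "Sub G" by (rule complete_lattice_Sub)
  show ?thesis by unfold_locales
qed

lemma top_Sub: "\<top>\<^bsub>Sub G\<^esub> = carrier G"
proof -
  interpret L: bounded_lattice "Sub G" by (rule bounded_lattice_Sub)
  show ?thesis
    using L.top_eq[of "carrier G"] subgroup_self subgroup.subset by auto
qed

lemma bottom_Sub: "\<bottom>\<^bsub>Sub G\<^esub> = {\<one>}"
proof -
  interpret L: bounded_lattice "Sub G" by (rule bounded_lattice_Sub)
  show ?thesis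
    using L.bottom_eq[of "{\<one>}"] triv_subgroup subgroup.one_closed by auto
qed

lemma meet_Sub:
  assumes "subgroup A G" "subgroup B G"
  shows "A \<sqinter>\<^bsub>Sub G\<^esub> B = A \<inter> B"
proof -
  interpret L: complete_lattice "Sub G" by (rule complete_lattice_Sub)
  show ?thesis
    using L.meet_left[of A B] L.meet_right[of A B] L.meet_le[of "A \<inter> B" A B]
      subgroups_Inter_pair[OF assms] assms by auto
qed

lemma join_Sub_least:
  assumes "subgroup A G" "subgroup B G" "subgroup D G" "A \<subseteq> D" "B \<subseteq> D"
  shows "A \<squnion>\<^bsub>Sub G\<^esub> B \<subseteq> D"
proof -
  interpret L: complete_lattice "Sub G" by (rule complete_lattice_Sub)
  show ?thesis using L.join_le[of A D B] assms by simp
qed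

lemma join_Sub_upper:
  assumes "subgroup A G" "subgroup B G"
  shows "A \<subseteq> A \<squnion>\<^bsub>Sub G\<^esub> B" "B \<subseteq> A \<squnion>\<^bsub>Sub G\<^esub> B" "subgroup (A \<squnion>\<^bsub>Sub G\<^esub> B) G"
proof -
  interpret L: complete_lattice "Sub G" by (rule complete_lattice_Sub)
  show "A \<subseteq> A \<squnion>\<^bsub>Sub G\<^esub> B" "B \<subseteq> A \<squnion>\<^bsub>Sub G\<^esub> B"
    using L.join_left[of A B] L.join_right[of A B] assms by simp_all
  show "subgroup (A \<squnion>\<^bsub>Sub G\<^esub> B) G"
    using L.join_closed[of A B] assms by simp
qed

lemma Sup_Sub:
  assumes "\<And>A. A \<in> \<A> \<Longrightarrow> subgroup A G"
  shows "subgroup (\<Squnion>\<^bsub>Sub G\<^esub>\<A>) G" "A \<in> \<A> \<Longrightarrow> A \<subseteq> \<Squnion>\<^bsub>Sub G\<^esub>\<A>"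
    and "\<lbrakk>subgroup D G; \<And>A. A \<in> \<A> \<Longrightarrow> A \<subseteq> D\<rbrakk> \<Longrightarrow> \<Squnion>\<^bsub>Sub G\<^esub>\<A> \<subseteq> D"
proof -
  interpret L: complete_lattice "Sub G" by (rule complete_lattice_Sub)
  have \<A>: "\<A> \<subseteq> carrier (Sub G)" using assms by auto
  show "subgroup (\<Squnion>\<^bsub>Sub G\<^esub>\<A>) G" using L.sup_closed[OF \<A>] by simp
  show "A \<in> \<A> \<Longrightarrow> A \<subseteq> \<Squnion>\<^bsub>Sub G\<^esub>\<A>" using L.sup_upper[OF \<A>] by simp
  show "\<lbrakk>subgroup D G; \<And>A. A \<in> \<A> \<Longrightarrow> A \<subseteq> D\<rbrakk> \<Longrightarrow> \<Squnion>\<^bsub>Sub G\<^esub>\<A> \<subseteq> D"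
    using L.sup_least[OF \<A>, of D] by simp
qed

text \<open>The finite subfamilies are directed, so the union of their joins is already a subgroup.\<close>

lemma Sup_Sub_finite:
  assumes \<A>: "\<And>A. A \<in> \<A> \<Longrightarrow> subgroup A G" and x: "x \<in> \<Squnion>\<^bsub>Sub G\<^esub>\<A>"
  shows "\<exists>\<B> \<subseteq> \<A>. finite \<B> \<and> x \<in> \<Squnion>\<^bsub>Sub G\<^esub>\<B>"
proof -
  let ?U = "{x. \<exists>\<B> \<subseteq> \<A>. finite \<B> \<and> x \<in> \<Squnion>\<^bsub>Sub G\<^esub>\<B>}"
  have sub: "subgroup (\<Squnion>\<^bsub>Sub G\<^esub>\<B>) G" if "\<B> \<subseteq> \<A>" for \<B>
    using Sup_Sub(1) \<A> that by blast
  have mono: "\<Squnion>\<^bsub>Sub G\<^esub>\<B> \<subseteq> \<Squnion>\<^bsub>Sub G\<^esub>\<B>'" if "\<B> \<subseteq> \<B>'" "\<B>' \<subseteq> \<A>" for \<B> \<B>'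
    using that \<A> sub[OF that(2)] by (intro Sup_Sub(3)) (auto dest: Sup_Sub(2)[of \<B>', rotated])
  have "subgroup ?U G"
  proof (rule subgroupI)
    show "?U \<subseteq> carrier G" using subgroup.mem_carrier[OF sub] by blast
    \<comment> \<open>The empty subfamily is finite and its join is a subgroup, so \<open>?U\<close>
      is nonempty even when \<A> is empty.\<close>
    have "\<one> \<in> ?U" using subgroup.one_closed[OF sub[of "{}"]] by blast
    then show "?U \<noteq> {}" by blast
    show "inv a \<in> ?U" if a: "a \<in> ?U" for a
    proof -
      obtain \<B> where "\<B> \<subseteq> \<A>" "finite \<B>" "a \<in> \<Squnion>\<^bsub>Sub G\<^esub>\<B>"
        using a by blast
      then show ?thesis using subgroup.m_inv_closed[OF sub[of \<B>]] by blast
    qed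
    show "a \<otimes> b \<in> ?U" if ab: "a \<in> ?U" "b \<in> ?U" for a b
    proof -
      obtain \<B> \<B>' where B: "\<B> \<subseteq> \<A>" "finite \<B>" "a \<in> \<Squnion>\<^bsub>Sub G\<^esub>\<B>" "\<B>' \<subseteq> \<A>" "finite \<B>'" "b \<in> \<Squnion>\<^bsub>Sub G\<^esub>\<B>'"
        using ab by blast
      then have "a \<in> \<Squnion>\<^bsub>Sub G\<^esub>(\<B> \<union> \<B>')" "b \<in> \<Squnion>\<^bsub>Sub G\<^esub>(\<B> \<union> \<B>')"
        using mono[of \<B> "\<B> \<union> \<B>'"] mono[of \<B>' "\<B> \<union> \<B>'"] by auto
      then have "a \<otimes> b \<in> \<Squnion>\<^bsub>Sub G\<^esub>(\<B> \<union> \<B>')"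
        using subgroup.m_closed[OF sub[of "\<B> \<union> \<B>'"]] B by blast
      moreover have "\<B> \<union> \<B>' \<subseteq> \<A>" "finite (\<B> \<union> \<B>')" using B by auto
      ultimately show ?thesis by blast
    qed
  qed
  moreover have "A \<subseteq> ?U" if "A \<in> \<A>" for A
  proof
    fix a assume "a \<in> A"
    then have "a \<in> \<Squnion>\<^bsub>Sub G\<^esub>{A}"
      using Sup_Sub(2)[of "{A}" A] \<A>[OF that] by auto
    then show "a \<in> ?U" using that by blast
  qed
  ultimately have "\<Squnion>\<^bsub>Sub G\<^esub>\<A> \<subseteq> ?U"
    using Sup_Sub(3) \<A> by blast
  then show ?thesis using x by blast
qed

text \<open>A subgroup contains \<open>generate G {a}\<close> as soon as it contains
  \<open>a\<close>, so compactness reduces to \<open>Sup_Sub_finite\<close> for one element.\<close>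

lemma compact_element_cyclic:
  assumes a: "a \<in> carrier G"
  shows "compact_element (Sub G) (generate G {a})"
  unfolding compact_element_def
proof (intro conjI allI impI)
  have sub: "subgroup (generate G {a}) G" using generate_is_subgroup a by simp
  then show "generate G {a} \<in> carrier (Sub G)" by simp
  fix \<A> assume \<A>: "\<A> \<subseteq> carrier (Sub G)" and "generate G {a} \<sqsubseteq>\<^bsub>Sub G\<^esub> \<Squnion>\<^bsub>Sub G\<^esub>\<A>"
  then have "a \<in> \<Squnion>\<^bsub>Sub G\<^esub>\<A>" by (auto intro: generate.incl)
  then obtain \<B> where B: "\<B> \<subseteq> \<A>" "finite \<B>" "a \<in> \<Squnion>\<^bsub>Sub G\<^esub>\<B>"
    using Sup_Sub_finite[of \<A> a] \<A> by auto
  have "subgroup (\<Squnion>\<^bsub>Sub G\<^esub>\<B>) G" using Sup_Sub(1)[of \<B>] B \<A> by auto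
  then have "generate G {a} \<subseteq> \<Squnion>\<^bsub>Sub G\<^esub>\<B>" using generate_subgroup_incl B by simp
  then show "\<exists>\<B> \<subseteq> \<A>. finite \<B> \<and> generate G {a} \<sqsubseteq>\<^bsub>Sub G\<^esub> \<Squnion>\<^bsub>Sub G\<^esub>\<B>"
    using B by auto
qed

text \<open>Every subgroup is the join of the cyclic subgroups generated by its elements.\<close>

lemma algebraic_lattice_Sub: "algebraic_lattice (Sub G)"
  unfolding algebraic_lattice_def
proof (intro conjI ballI exI)
  show "complete_lattice (Sub G)" by (rule complete_lattice_Sub)
  fix A assume "A \<in> carrier (Sub G)"
  then have A: "subgroup A G" by simp
  let ?\<C> = "(\<lambda>a. generate G {a}) ` A"
  have gen: "subgroup c G" "c \<subseteq> A" if c: "c \<in> ?\<C>" for c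
  proof -
    obtain a where a: "a \<in> A" "c = generate G {a}" using c by blast
    show "subgroup c G" using generate_is_subgroup[of "{a}"] subgroup.mem_carrier[OF A] a by simp
    show "c \<subseteq> A" using generate_subgroup_incl[OF _ A, of "{a}"] a by simp
  qed
  show "compact_element (Sub G) c" if "c \<in> ?\<C>" for c
    using that compact_element_cyclic subgroup.mem_carrier[OF A] by auto
  show "A = \<Squnion>\<^bsub>Sub G\<^esub>?\<C>"
  proof
    show "A \<subseteq> \<Squnion>\<^bsub>Sub G\<^esub>?\<C>"
    proof
      fix a assume "a \<in> A"
      then have "generate G {a} \<subseteq> \<Squnion>\<^bsub>Sub G\<^esub>?\<C>"
        using gen(1) by (intro Sup_Sub(2)) auto
      then show "a \<in> \<Squnion>\<^bsub>Sub G\<^esub>?\<C>" by (auto intro: generate.incl)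
    qed
    show "\<Squnion>\<^bsub>Sub G\<^esub>?\<C> \<subseteq> A"
      using gen A by (intro Sup_Sub(3))
  qed
qed

end

section \<open>Abelian groups: joins as products, and modularity\<close>

context
  fixes G :: "'a monoid" (structure)
  assumes G: "comm_group G"
begin

interpretation comm_group G by (rule G)

text \<open>Commutativity enters through \<open>mult_subgroups\<close>: the product set is itself a
  subgroup, and any subgroup containing both factors contains it.\<close>

lemma join_Sub:
  assumes A: "subgroup A G" and B: "subgroup B G"
  shows "A \<squnion>\<^bsub>Sub G\<^esub> B = A <#> B"
proof
  have incl: "A \<subseteq> A <#> B" "B \<subseteq> A <#> B"
  proof -
    show "A \<subseteq> A <#> B"
    proof
      fix a assume "a \<in> A"
      then show "a \<in> A <#> B"
        using subgroup.one_closed[OF B] r_one[OF subgroup.mem_carrier[OF A]] unfolding set_mult_def by force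
    qed
    show "B \<subseteq> A <#> B"
    proof
      fix b assume "b \<in> B"
      then show "b \<in> A <#> B"
        using subgroup.one_closed[OF A] l_one[OF subgroup.mem_carrier[OF B]] unfolding set_mult_def by force
    qed
  qed
  then show "A \<squnion>\<^bsub>Sub G\<^esub> B \<subseteq> A <#> B"
    using join_Sub_least[OF is_group A B mult_subgroups[OF A B]] by blast
  show "A <#> B \<subseteq> A \<squnion>\<^bsub>Sub G\<^esub> B"
    using join_Sub_upper(1,2)[OF is_group A B] subgroup.m_closed[OF join_Sub_upper(3)[OF is_group A B]]
    unfolding set_mult_def by blast
qed

text \<open>Dedekind's law for product sets: if \<open>a \<otimes> b\<close> lies in
  \<open>D\<close> and \<open>a\<close> lies in \<open>A \<subseteq> D\<close>, then
  \<open>b = inv a \<otimes> (a \<otimes> b)\<close> lies in \<open>D\<close> as well.\<close>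

lemma modular_lattice_Sub: "modular_lattice (Sub G)"
  unfolding modular_lattice_def
proof (intro conjI ballI impI)
  show "lattice (Sub G)" using bounded_lattice_Sub[OF is_group] by (rule bounded_lattice.axioms)
  fix A B D assume "A \<in> carrier (Sub G)" "B \<in> carrier (Sub G)" "D \<in> carrier (Sub G)" "A \<sqsubseteq>\<^bsub>Sub G\<^esub> D"
  then have A: "subgroup A G" and B: "subgroup B G" and D: "subgroup D G" and AD: "A \<subseteq> D" by auto
  have BD: "subgroup (B \<inter> D) G" by (rule subgroups_Inter_pair[OF B D])
  have "A <#> (B \<inter> D) = (A <#> B) \<inter> D"
  proof
    show "A <#> (B \<inter> D) \<subseteq> (A <#> B) \<inter> D"
      using AD subgroup.m_closed[OF D] unfolding set_mult_def by blast
    show "(A <#> B) \<inter> D \<subseteq> A <#> (B \<inter> D)"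
    proof
      fix x assume "x \<in> (A <#> B) \<inter> D"
      then obtain a b where ab: "a \<in> A" "b \<in> B" "x = a \<otimes> b" "a \<otimes> b \<in> D"
        unfolding set_mult_def by blast
      have "inv a \<otimes> (a \<otimes> b) = b"
        using ab subgroup.mem_carrier[OF A] subgroup.mem_carrier[OF B] by (simp add: m_assoc[symmetric])
      moreover have "inv a \<otimes> (a \<otimes> b) \<in> D"
        using ab AD subgroup.m_closed[OF D] subgroup.m_inv_closed[OF D] by blast
      ultimately show "x \<in> A <#> (B \<inter> D)"
        using ab unfolding set_mult_def by auto
    qed
  qed
  then show "A \<squnion>\<^bsub>Sub G\<^esub> (B \<sqinter>\<^bsub>Sub G\<^esub> D) = (A \<squnion>\<^bsub>Sub G\<^esub> B) \<sqinter>\<^bsub>Sub G\<^esub> D"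
    using A B D BD by (simp add: meet_Sub[OF is_group] join_Sub mult_subgroups)
qed

end

lemma (in group_hom) subgroup_vimage:
  assumes "subgroup B H"
  shows "subgroup {x \<in> carrier G. h x \<in> B} G"
proof (rule G.subgroupI)
  show "{x \<in> carrier G. h x \<in> B} \<noteq> {}"
    using subgroup.one_closed[OF assms] by (auto intro!: exI[of _ "\<one>"])
qed (simp_all add: subgroup.m_closed[OF assms] subgroup.m_inv_closed[OF assms])

text \<open>This is the first half of (N1) for subgroups. If \<open>h x = h a\<close>, then
  \<open>x\<close> is the product of \<open>a\<close> and \<open>inv a \<otimes> x\<close>, and the
  latter lies in the kernel.\<close>

lemma vimage_image_Sub:
  fixes G :: "'a monoid" (structure)
  assumes "group_hom G H h" and G: "comm_group G" and A: "subgroup A G"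
  shows "{x \<in> carrier G. h x \<in> h ` A} = A \<squnion>\<^bsub>Sub G\<^esub> {x \<in> carrier G. h x \<in> {\<one>\<^bsub>H\<^esub>}}" (is "?L = _ \<squnion>\<^bsub>_\<^esub> ?K")
proof -
  interpret group_hom G H h by fact
  have K: "subgroup ?K G" using H.triv_subgroup by (rule subgroup_vimage)
  have "?L = A <#> ?K"
  proof
    show "?L \<subseteq> A <#> ?K"
    proof
      fix x assume "x \<in> ?L"
      then obtain a where a: "x \<in> carrier G" "a \<in> A" "h x = h a" by auto
      then have ac: "a \<in> carrier G" using subgroup.mem_carrier[OF A] by simp
      have "x = a \<otimes> (inv a \<otimes> x)" using a ac by (simp add: G.m_assoc[symmetric])
      moreover have "inv a \<otimes> x \<in> ?K" using a ac by simp
      ultimately show "x \<in> A <#> ?K" using a unfolding set_mult_def by blast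
    qed
    show "A <#> ?K \<subseteq> ?L"
      using subgroup.mem_carrier[OF A] unfolding set_mult_def by auto
  qed
  then show ?thesis using join_Sub[OF G A K] by simp
qed

section \<open>Free abelian groups on the fibres\<close>

text \<open>The action of the free abelian group functor on functions. As \<open>\<phi>\<close> is
  total on its type, restriction to a fibre is expressed by bounding
  \<open>Poly_Mapping.keys\<close>.\<close>

definition frag_map :: "('a \<Rightarrow> 'b) \<Rightarrow> ('a \<Rightarrow>\<^sub>0 int) \<Rightarrow> 'b \<Rightarrow>\<^sub>0 int" where
  "frag_map \<phi> = frag_extend (frag_of \<circ> \<phi>)"

lemma frag_map_of [simp]: "frag_map \<phi> (frag_of s) = frag_of (\<phi> s)"
  and frag_map_zero [simp]: "frag_map \<phi> 0 = 0"
  and frag_map_add: "frag_map \<phi> (x + y) = frag_map \<phi> x + frag_map \<phi> y"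
  and frag_map_diff: "frag_map \<phi> (x - y) = frag_map \<phi> x - frag_map \<phi> y"
  by (simp_all add: frag_map_def frag_extend_add frag_extend_diff)

lemma frag_map_frag_map: "frag_map \<psi> (frag_map \<phi> x) = frag_map (\<psi> \<circ> \<phi>) x"
  unfolding frag_map_def by (simp add: frag_extend_compose o_assoc)

lemma frag_map_cong:
  "Poly_Mapping.keys x \<subseteq> S \<Longrightarrow> (\<And>s. s \<in> S \<Longrightarrow> \<phi> s = \<psi> s) \<Longrightarrow> frag_map \<phi> x = frag_map \<psi> x"
  unfolding frag_map_def by (rule frag_extend_eq) auto

lemma frag_map_ident:
  "Poly_Mapping.keys x \<subseteq> S \<Longrightarrow> (\<And>s. s \<in> S \<Longrightarrow> \<phi> s = s) \<Longrightarrow> frag_map \<phi> x = x"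
  using frag_map_cong[of x S \<phi> "\<lambda>s. s"] frag_expansion[of x] by (simp add: frag_map_def o_def)

lemma keys_frag_map: "Poly_Mapping.keys (frag_map \<phi> x) \<subseteq> \<phi> ` Poly_Mapping.keys x"
  using keys_frag_extend[of "frag_of \<circ> \<phi>" x] by (auto simp: frag_map_def)

lemma frag_map_image:
  "frag_map \<phi> ` carrier (free_Abelian_group S) = carrier (free_Abelian_group (\<phi> ` S))"
proof (intro subset_antisym subsetI)
  fix y assume "y \<in> frag_map \<phi> ` carrier (free_Abelian_group S)"
  then show "y \<in> carrier (free_Abelian_group (\<phi> ` S))"
    using keys_frag_map[of \<phi>] by fastforce
next
  fix y assume "y \<in> carrier (free_Abelian_group (\<phi> ` S))"
  then have y: "Poly_Mapping.keys y \<subseteq> \<phi> ` S" by simp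
  \<comment> \<open>A right inverse of \<open>\<phi>\<close> on the image of \<open>S\<close> lifts
    all basis elements at once; extending it linearly gives a preimage of \<open>y\<close>.\<close>
  let ?x = "frag_map (inv_into S \<phi>) y"
  have "Poly_Mapping.keys ?x \<subseteq> S"
    using keys_frag_map[of "inv_into S \<phi>" y] y inv_into_into[of _ \<phi> S] by blast
  moreover have "frag_map \<phi> ?x = y"
    unfolding frag_map_frag_map using y by (rule frag_map_ident) (simp add: f_inv_into_f)
  ultimately show "y \<in> frag_map \<phi> ` carrier (free_Abelian_group S)"
    by (metis image_eqI carrier_free_Abelian_group_iff)
qed

lemma hom_frag_map:
  assumes "\<phi> \<in> S \<rightarrow> T"
  shows "frag_map \<phi> \<in> hom (free_Abelian_group S) (free_Abelian_group T)"
proof (rule homI)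
  fix x assume "x \<in> carrier (free_Abelian_group S)"
  then show "frag_map \<phi> x \<in> carrier (free_Abelian_group T)"
    using keys_frag_map[of \<phi> x] assms by auto
qed (simp add: frag_map_add)

text \<open>Stated for differences because \<open>free_Abelian_group_induct\<close> builds elements
  from basis elements by subtraction.\<close>

lemma subgroup_free_Abelian_group_diff:
  assumes A: "subgroup A (free_Abelian_group S)" and xy: "x \<in> A" "y \<in> A"
  shows "x - y \<in> A"
proof -
  have "Poly_Mapping.keys y \<subseteq> S"
    using subgroup.mem_carrier[OF A xy(2)] by simp
  then have "- y \<in> A" using subgroup.m_inv_closed[OF A xy(2)] by simp
  then show ?thesis using subgroup.m_closed[OF A xy(1), of "- y"] by simp
qed

text \<open>The endomorphism \<open>frag_map (\<psi> \<circ> \<phi>)\<close> kills the kernel of \<open>frag_map \<phi>\<close>, hence \<open>x\<close> there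
  equals \<open>x - frag_map (\<psi> \<circ> \<phi>) x\<close>, a combination of the differences \<open>frag_of s - frag_of (\<psi> (\<phi> s))\<close>.\<close>

lemma frag_map_kernel:
  assumes A: "subgroup A (free_Abelian_group S)"
    and gen: "\<And>s. s \<in> S \<Longrightarrow> frag_of s - frag_of (\<psi> (\<phi> s)) \<in> A"
    and x: "Poly_Mapping.keys x \<subseteq> S" "frag_map \<phi> x = 0"
  shows "x \<in> A"
proof -
  have "x - frag_map \<psi> (frag_map \<phi> x) \<in> A"
  proof (rule free_Abelian_group_induct[OF x(1), of "\<lambda>x. x - frag_map \<psi> (frag_map \<phi> x) \<in> A"])
    show "0 - frag_map \<psi> (frag_map \<phi> 0) \<in> A"
      using subgroup.one_closed[OF A] by simp
  next
    fix x y assume "x - frag_map \<psi> (frag_map \<phi> x) \<in> A" "y - frag_map \<psi> (frag_map \<phi> y) \<in> A"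
    then have "(x - frag_map \<psi> (frag_map \<phi> x)) - (y - frag_map \<psi> (frag_map \<phi> y)) \<in> A"
      by (rule subgroup_free_Abelian_group_diff[OF A])
    then show "x - y - frag_map \<psi> (frag_map \<phi> (x - y)) \<in> A"
      by (simp add: frag_map_diff algebra_simps)
  next
    fix s assume "s \<in> S"
    then show "frag_of s - frag_map \<psi> (frag_map \<phi> (frag_of s)) \<in> A"
      using gen by simp
  qed
  then show ?thesis using x(2) by simp
qed

section \<open>The functor \<open>H\<close> and the orean form of its subgroups\<close>

lemma H_map_eq: "H_map N f = frag_map (push N f)"
  by (simp add: H_map_def frag_map_def o_def)

lemma mod_form_simps [simp]:
  "fibre (mod_form C N) X = Sub (H_ob N X)"
  "push (mod_form C N) f A = H_map N f ` A"
  "pull (mod_form C N) f B = {x \<in> carrier (H_ob N (Dom C f)). H_map N f x \<in> B}"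
  by (simp_all add: mod_form_def)

lemma comm_group_H_ob: "comm_group (H_ob N X)"
  unfolding H_ob_def by (rule abelian_free_Abelian_group)

lemma group_H_ob: "group (H_ob N X)"
  unfolding H_ob_def by (rule group_free_Abelian_group)

lemma mult_H_ob: "x \<otimes>\<^bsub>H_ob N X\<^esub> y = x + y"
  by (simp add: H_ob_def)

context orean_form
begin

lemma H_map_Id: "X \<in> Ob C \<Longrightarrow> x \<in> carrier (H_ob F X) \<Longrightarrow> H_map F (Id C X) x = x"
  unfolding H_map_eq H_ob_def
  by (rule frag_map_ident[of _ "carrier (fibre F X)"]) (simp_all add: push_Id)

lemma H_map_Comp:
  "f \<in> Hom C X Y \<Longrightarrow> g \<in> Hom C Y Z \<Longrightarrow> x \<in> carrier (H_ob F X) \<Longrightarrow>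
    H_map F (Comp C g f) x = H_map F g (H_map F f x)"
  unfolding H_map_eq H_ob_def frag_map_frag_map
  by (rule frag_map_cong[of _ "carrier (fibre F X)"]) (simp_all add: push_Comp)

lemma H_map_group_hom: "f \<in> Hom C X Y \<Longrightarrow> group_hom (H_ob F X) (H_ob F Y) (H_map F f)"
  unfolding H_map_eq H_ob_def
  by (intro group_hom.intro group_hom_axioms.intro group_free_Abelian_group hom_frag_map push_closed)

lemma H_map_in: "f \<in> Hom C X Y \<Longrightarrow> x \<in> carrier (H_ob F X) \<Longrightarrow> H_map F f x \<in> carrier (H_ob F Y)"
  by (rule group_hom.hom_closed[OF H_map_group_hom])

lemma Ab_functor_H: "Ab_functor C (H_ob F) (H_map F)"
  by (intro Ab_functor.intro Ab_functor_axioms.intro category_axioms comm_group_H_ob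
      H_map_Id H_map_Comp group_hom.homh[OF H_map_group_hom])

text \<open>Direct and inverse image along a homomorphism are adjoint for inclusion, and
  functoriality of \<open>H_map\<close> makes both transports functorial.\<close>

lemma orean_form_mod_form: "orean_form C (mod_form C F)"
proof -
  have sub: "x \<in> carrier (H_ob F X)" if "subgroup A (H_ob F X)" "x \<in> A" for A X x
    by (rule subgroup.mem_carrier[OF that])
  have dom: "Dom C f = X" if "f \<in> Hom C X Y" for f X Y
    using that by (simp add: Hom_def)
  \<comment> \<open>\<open>isotone\<close> includes the order axioms of both fibres, so they are
    provided separately.\<close>
  have wpo: "weak_partial_order (Sub (H_ob F X))" for X
  proof -
    interpret bounded_lattice "Sub (H_ob F X)" by (rule bounded_lattice_Sub[OF group_H_ob])
    show ?thesis by unfold_locales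
  qed
  let ?M = "mod_form C F"
  show ?thesis
  proof (intro orean_form.intro orean_form_axioms.intro category_axioms)
    fix X show "bounded_lattice (fibre ?M X)" by (simp add: bounded_lattice_Sub[OF group_H_ob])
  next
    fix f X Y assume f: "f \<in> Hom C X Y"
    have push: "subgroup (H_map F f ` A) (H_ob F Y)" if "subgroup A (H_ob F X)" for A
      by (rule group_hom.subgroup_img_is_subgroup[OF H_map_group_hom[OF f] that])
    have pull: "subgroup {x \<in> carrier (H_ob F X). H_map F f x \<in> B} (H_ob F X)"
      if "subgroup B (H_ob F Y)" for B
      by (rule group_hom.subgroup_vimage[OF H_map_group_hom[OF f] that])
    show "push ?M f \<in> carrier (fibre ?M X) \<rightarrow> carrier (fibre ?M Y)"
      using push by auto
    show "pull ?M f \<in> carrier (fibre ?M Y) \<rightarrow> carrier (fibre ?M X)"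
      using pull dom[OF f] by auto
    show "isotone (fibre ?M X) (fibre ?M Y) (push ?M f)"
      by (rule isotoneI) (auto simp: wpo)
    show "isotone (fibre ?M Y) (fibre ?M X) (pull ?M f)"
      by (rule isotoneI) (auto simp: wpo)
    show "push ?M f A \<sqsubseteq>\<^bsub>fibre ?M Y\<^esub> B \<longleftrightarrow> A \<sqsubseteq>\<^bsub>fibre ?M X\<^esub> pull ?M f B"
      if "A \<in> carrier (fibre ?M X)" for A B
      using that sub[of A X] dom[OF f] by auto
  next
    fix f g X Y Z assume f: "f \<in> Hom C X Y" and g: "g \<in> Hom C Y Z"
    show "push ?M (Comp C g f) A = push ?M g (push ?M f A)" if "A \<in> carrier (fibre ?M X)" for A
      using that H_map_Comp[OF f g sub[of A X]] by (simp add: image_image)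
    show "pull ?M (Comp C g f) B = pull ?M f (pull ?M g B)" for B
      using H_map_Comp[OF f g] H_map_in[OF f] dom[OF f] dom[OF g] dom[OF Comp_Hom[OF f g]]
      by auto
  next
    fix X A assume X: "X \<in> Ob C" and A: "A \<in> carrier (fibre ?M X)"
    show "push ?M (Id C X) A = A"
      using A H_map_Id[OF X sub[of A X]] by simp
    show "pull ?M (Id C X) A = A"
      using A H_map_Id[OF X] sub[of A X] dom[OF Id_Hom[OF X]] by auto
  qed
qed

lemma Ker_mod_form:
  assumes f: "f \<in> Hom C X Y"
  shows "Ker_cluster C (mod_form C F) f = {x \<in> carrier (H_ob F X). H_map F f x = 0}"
proof -
  have "\<bottom>\<^bsub>Sub (H_ob F Y)\<^esub> = {0}"
    using bottom_Sub[OF group_H_ob] by (simp add: H_ob_def)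
  then show ?thesis
    using f by (simp add: Ker_cluster_def Hom_def)
qed

text \<open>\<open>H_map\<close> sends basis elements to basis elements, so its image is again free
  on part of the basis; for noetherian forms \<open>push_image\<close> identifies that part as a
  down-set.\<close>

lemma Im_mod_form:
  assumes f: "f \<in> Hom C X Y"
  shows "Im_cluster C (mod_form C F) f = carrier (free_Abelian_group (push F f ` carrier (fibre F X)))"
  using f by (simp add: Im_cluster_def Hom_def top_Sub[OF group_H_ob])
    (simp add: H_ob_def H_map_eq frag_map_image)

end

section \<open>The form of subgroups\<close>

context noetherian_form
begin

text \<open>The adjunction at the bottom cluster turns an inclusion into an equation between
  clusters, which is what basis elements of the free group can detect.\<close>

lemma push_le_bottom_iff:
  assumes f: "f \<in> Hom C X Y" and S: "S \<in> carrier (fibre F X)"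
  shows "push F f S = \<bottom>\<^bsub>fibre F Y\<^esub> \<longleftrightarrow> S \<sqsubseteq>\<^bsub>fibre F X\<^esub> Ker_cluster C F f"
proof -
  have Y: "Y \<in> Ob C" using Hom_Ob f by blast
  have "push F f S = \<bottom>\<^bsub>fibre F Y\<^esub> \<longleftrightarrow> push F f S \<sqsubseteq>\<^bsub>fibre F Y\<^esub> \<bottom>\<^bsub>fibre F Y\<^esub>"
    using fibre_antisym[OF Y] fibre_refl[OF Y] bottom_in[OF Y] bottom_le[OF Y] push_in[OF f S] by metis
  then show ?thesis
    using push_pull[OF f S bottom_in[OF Y]] Ker_eq[OF f] by simp
qed

text \<open>By (N1), \<open>pull F f (push F f S)\<close> is \<open>S\<close> joined with
  \<open>Ker f\<close>, hence above \<open>S\<close> joined with \<open>K\<close>. The adjunction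
  gives one inequality, monotonicity the other.\<close>

lemma push_join_absorb:
  assumes f: "f \<in> Hom C X Y" and S: "S \<in> carrier (fibre F X)" and K: "K \<in> carrier (fibre F X)"
    and le: "K \<sqsubseteq>\<^bsub>fibre F X\<^esub> Ker_cluster C F f"
  shows "push F f (S \<squnion>\<^bsub>fibre F X\<^esub> K) = push F f S"
proof -
  have X: "X \<in> Ob C" and Y: "Y \<in> Ob C" using Hom_Ob[OF f] .
  interpret L: bounded_lattice "fibre F X" by (rule fibre_bounded_lattice[OF X])
  let ?P = "S \<squnion>\<^bsub>fibre F X\<^esub> Ker_cluster C F f"
  have Ker: "Ker_cluster C F f \<in> carrier (fibre F X)" by (rule Ker_in[OF f])
  have SK: "S \<squnion>\<^bsub>fibre F X\<^esub> K \<in> carrier (fibre F X)" using S K by (rule L.join_closed)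
  have P: "?P \<in> carrier (fibre F X)" using S Ker by (rule L.join_closed)
  have "K \<sqsubseteq>\<^bsub>fibre F X\<^esub> ?P"
    using le L.join_right[OF S Ker] L.le_trans K Ker P by blast
  then have "S \<squnion>\<^bsub>fibre F X\<^esub> K \<sqsubseteq>\<^bsub>fibre F X\<^esub> ?P"
    using L.join_left[OF S Ker] by (intro L.join_le S K P)
  then have "push F f (S \<squnion>\<^bsub>fibre F X\<^esub> K) \<sqsubseteq>\<^bsub>fibre F Y\<^esub> push F f S"
    using push_pull[OF f SK push_in[OF f S]] pull_push[OF f S] by simp
  moreover have "push F f S \<sqsubseteq>\<^bsub>fibre F Y\<^esub> push F f (S \<squnion>\<^bsub>fibre F X\<^esub> K)"
    using push_isotone[OF f] L.join_left[OF S K] S SK by (simp add: isotone_def)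
  ultimately show ?thesis
    using fibre_antisym[OF Y push_in[OF f SK] push_in[OF f S]] by simp
qed

text \<open>By the second half of (N1), a cluster below \<open>Im f\<close> is the push of its own
  pullback.\<close>

lemma push_image:
  assumes f: "f \<in> Hom C X Y"
  shows "push F f ` carrier (fibre F X) =
    {T \<in> carrier (fibre F Y). T \<sqsubseteq>\<^bsub>fibre F Y\<^esub> Im_cluster C F f}"
proof (intro subset_antisym subsetI)
  have X: "X \<in> Ob C" and Y: "Y \<in> Ob C" using Hom_Ob[OF f] .
  interpret L: bounded_lattice "fibre F Y" by (rule fibre_bounded_lattice[OF Y])
  fix T
  {
    assume "T \<in> push F f ` carrier (fibre F X)"
    then show "T \<in> {T \<in> carrier (fibre F Y). T \<sqsubseteq>\<^bsub>fibre F Y\<^esub> Im_cluster C F f}"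
      using push_in[OF f] push_isotone[OF f] le_top[OF X] top_in[OF X] Im_eq[OF f]
      by (auto simp: isotone_def)
  next
    assume "T \<in> {T \<in> carrier (fibre F Y). T \<sqsubseteq>\<^bsub>fibre F Y\<^esub> Im_cluster C F f}"
    then have T: "T \<in> carrier (fibre F Y)" "T \<sqsubseteq>\<^bsub>fibre F Y\<^esub> Im_cluster C F f" by auto
    then have "push F f (pull F f T) = T"
      using push_pull_meet[OF f T(1)] L.le_iff_join[OF T(1) Im_in[OF f]] by simp
    then show "T \<in> push F f ` carrier (fibre F X)"
      using pull_in[OF f T(1)] by (metis imageI)
  }
qed

text \<open>The element \<open>[Ker f] - [\<bottom>]\<close> of the kernel of \<open>H(f)\<close> detects the cluster \<open>Ker f\<close>.\<close>

lemma Ker_mod_form_le_iff: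
  assumes f: "f \<in> Hom C X Y" and g: "g \<in> Hom C X Z"
  shows "Ker_cluster C (mod_form C F) f \<subseteq> Ker_cluster C (mod_form C F) g \<longleftrightarrow>
    Ker_cluster C F f \<sqsubseteq>\<^bsub>fibre F X\<^esub> Ker_cluster C F g"
proof
  have X: "X \<in> Ob C" using Hom_Ob f by blast
  assume sub: "Ker_cluster C (mod_form C F) f \<subseteq> Ker_cluster C (mod_form C F) g"
  let ?K = "Ker_cluster C F f" and ?B = "\<bottom>\<^bsub>fibre F X\<^esub>"
  have K: "?K \<in> carrier (fibre F X)" and B: "?B \<in> carrier (fibre F X)"
    by (rule Ker_in[OF f], rule bottom_in[OF X])
  have bot: "push F p ?B = \<bottom>\<^bsub>fibre F W\<^esub>" if "p \<in> Hom C X W" for p W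
    using push_le_bottom_iff[OF that B] bottom_le[OF X Ker_in[OF that]] by simp
  have "push F f ?K = push F f ?B"
    using push_le_bottom_iff[OF f K] fibre_refl[OF X K] bot[OF f] by simp
  then have "frag_of ?K - frag_of ?B \<in> Ker_cluster C (mod_form C F) f"
    using K B keys_diff[of "frag_of ?K" "frag_of ?B"]
    by (auto simp: Ker_mod_form[OF f] H_ob_def H_map_eq frag_map_diff)
  then have "frag_of (push F g ?K) = frag_of (push F g ?B)"
    using sub by (auto simp: Ker_mod_form[OF g] H_map_eq frag_map_diff)
  then show "?K \<sqsubseteq>\<^bsub>fibre F X\<^esub> Ker_cluster C F g"
    using push_le_bottom_iff[OF g K] bot[OF g] by (simp add: frag_of_eq)
next
  assume le: "Ker_cluster C F f \<sqsubseteq>\<^bsub>fibre F X\<^esub> Ker_cluster C F g"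
  \<comment> \<open>By (N1), pulling back the push of \<open>S\<close> only adds
    \<open>Ker f\<close>, which \<open>push F g\<close> absorbs. So \<open>push F g\<close> factors
    through \<open>push F f\<close> on the fibre; extended linearly, \<open>H(g)\<close> factors
    through \<open>H(f)\<close> and vanishes on its kernel.\<close>
  have abs: "push F g (pull F f (push F f S)) = push F g S" if "S \<in> carrier (fibre F X)" for S
    using push_join_absorb[OF g that Ker_in[OF f] le] pull_push[OF f that] by simp
  show "Ker_cluster C (mod_form C F) f \<subseteq> Ker_cluster C (mod_form C F) g"
  proof
    fix x assume "x \<in> Ker_cluster C (mod_form C F) f"
    then have x: "x \<in> carrier (H_ob F X)" "frag_map (push F f) x = 0"
      by (simp_all add: Ker_mod_form[OF f] H_map_eq)
    have "frag_map (push F g) x = frag_map (push F g \<circ> pull F f \<circ> push F f) x"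
      using x(1) by (intro frag_map_cong[of _ "carrier (fibre F X)"]) (simp_all add: H_ob_def abs)
    also have "\<dots> = frag_map (push F g \<circ> pull F f) (frag_map (push F f) x)"
      by (simp add: frag_map_frag_map)
    also have "\<dots> = 0" by (simp add: x(2))
    finally show "x \<in> Ker_cluster C (mod_form C F) g"
      using x(1) by (simp add: Ker_mod_form[OF g] H_map_eq)
  qed
qed

text \<open>In terms of supports, comparing and intersecting images reduces to doing so for
  principal down-sets.\<close>

lemma Im_mod_form_eq:
  assumes f: "f \<in> Hom C X Y"
  shows "Im_cluster C (mod_form C F) f =
    {y. Poly_Mapping.keys y \<subseteq> {T \<in> carrier (fibre F Y). T \<sqsubseteq>\<^bsub>fibre F Y\<^esub> Im_cluster C F f}}"
  by (rule Set.set_eqI) (simp add: Im_mod_form[OF f] push_image[OF f])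

lemma Im_mod_form_le_iff:
  assumes f: "f \<in> Hom C X Z" and g: "g \<in> Hom C Y Z"
  shows "Im_cluster C (mod_form C F) f \<subseteq> Im_cluster C (mod_form C F) g \<longleftrightarrow>
    Im_cluster C F f \<sqsubseteq>\<^bsub>fibre F Z\<^esub> Im_cluster C F g"
proof
  have Z: "Z \<in> Ob C" using Hom_Ob f by blast
  assume sub: "Im_cluster C (mod_form C F) f \<subseteq> Im_cluster C (mod_form C F) g"
  \<comment> \<open>The basis element of the top of the down-set below \<open>Im f\<close> detects
    the inclusion.\<close>
  have "frag_of (Im_cluster C F f) \<in> Im_cluster C (mod_form C F) f"
    using Im_in[OF f] fibre_refl[OF Z] by (simp add: Im_mod_form_eq[OF f])
  then show "Im_cluster C F f \<sqsubseteq>\<^bsub>fibre F Z\<^esub> Im_cluster C F g"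
    using sub by (auto simp: Im_mod_form_eq[OF g])
next
  have Z: "Z \<in> Ob C" using Hom_Ob f by blast
  interpret L: bounded_lattice "fibre F Z" by (rule fibre_bounded_lattice[OF Z])
  assume "Im_cluster C F f \<sqsubseteq>\<^bsub>fibre F Z\<^esub> Im_cluster C F g"
  then have "{T \<in> carrier (fibre F Z). T \<sqsubseteq>\<^bsub>fibre F Z\<^esub> Im_cluster C F f} \<subseteq>
      {T \<in> carrier (fibre F Z). T \<sqsubseteq>\<^bsub>fibre F Z\<^esub> Im_cluster C F g}"
    using L.le_trans Im_in[OF f] Im_in[OF g] by blast
  then show "Im_cluster C (mod_form C F) f \<subseteq> Im_cluster C (mod_form C F) g"
    unfolding Im_mod_form_eq[OF f] Im_mod_form_eq[OF g] by blast
qed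

lemma quotients_mod_form: "quotients C (mod_form C F) = quotients C F"
proof -
  interpret M: orean_form C "mod_form C F" by (rule orean_form_mod_form)
  have "p \<in> quotients C (mod_form C F) \<longleftrightarrow> p \<in> quotients C F" if "p \<in> Ar C" for p
    using Ker_mod_form_le_iff[OF Ar_Hom[OF that]]
    unfolding M.quotient_iff[OF Ar_Hom[OF that]] quotient_iff[OF Ar_Hom[OF that]] by simp
  then show ?thesis using quotients_Ar M.quotients_Ar by blast
qed

lemma embeddings_mod_form: "embeddings C (mod_form C F) = embeddings C F"
proof -
  interpret M: orean_form C "mod_form C F" by (rule orean_form_mod_form)
  have "i \<in> embeddings C (mod_form C F) \<longleftrightarrow> i \<in> embeddings C F" if "i \<in> Ar C" for i
    using Im_mod_form_le_iff[OF _ Ar_Hom[OF that]]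
    unfolding M.embedding_iff[OF Ar_Hom[OF that]] embedding_iff[OF Ar_Hom[OF that]] by simp
  then show ?thesis using embeddings_Ar M.embeddings_Ar by blast
qed

lemma Ker_mod_form_join:
  assumes f: "f \<in> Hom C X Y" and g: "g \<in> Hom C X Z" and q: "q \<in> Hom C X W"
    and eq: "Ker_cluster C F q = Ker_cluster C F f \<squnion>\<^bsub>fibre F X\<^esub> Ker_cluster C F g"
  shows "Ker_cluster C (mod_form C F) f \<squnion>\<^bsub>Sub (H_ob F X)\<^esub> Ker_cluster C (mod_form C F) g =
    Ker_cluster C (mod_form C F) q" (is "?J = _")
proof
  interpret M: orean_form C "mod_form C F" by (rule orean_form_mod_form)
  have X: "X \<in> Ob C" using Hom_Ob f by blast
  interpret L: bounded_lattice "fibre F X" by (rule fibre_bounded_lattice[OF X])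
  let ?Kf = "Ker_cluster C F f" and ?Kg = "Ker_cluster C F g"
  have Kf: "?Kf \<in> carrier (fibre F X)" and Kg: "?Kg \<in> carrier (fibre F X)"
    using Ker_in f g by auto
  have sub: "subgroup (Ker_cluster C (mod_form C F) p) (H_ob F X)" if "p \<in> Hom C X V" for p V
    using M.Ker_in[OF that] by simp
  note J = join_Sub_upper[OF group_H_ob sub[OF f] sub[OF g]]
  show "?J \<subseteq> Ker_cluster C (mod_form C F) q"
    using join_Sub_least[OF group_H_ob sub[OF f] sub[OF g] sub[OF q]] Ker_mod_form_le_iff[OF _ q]
      f g eq L.join_left[OF Kf Kg] L.join_right[OF Kf Kg] by simp
  have diff: "frag_of S - frag_of (S \<squnion>\<^bsub>fibre F X\<^esub> Ker_cluster C F p) \<in> Ker_cluster C (mod_form C F) p"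
    if p: "p \<in> Hom C X V" and S: "S \<in> carrier (fibre F X)" for p V S
  proof -
    have Kp: "Ker_cluster C F p \<in> carrier (fibre F X)" by (rule Ker_in[OF p])
    have "push F p (S \<squnion>\<^bsub>fibre F X\<^esub> Ker_cluster C F p) = push F p S"
      by (rule push_join_absorb[OF p S Kp fibre_refl[OF X Kp]])
    then show ?thesis
      using S L.join_closed[OF S Kp] keys_diff[of "frag_of S" "frag_of (S \<squnion>\<^bsub>fibre F X\<^esub> Ker_cluster C F p)"]
      by (auto simp: Ker_mod_form[OF p] H_ob_def H_map_eq frag_map_diff)
  qed
  \<comment> \<open>By (N1) for \<open>q\<close>, the second basis element is \<open>S\<close>
    joined with both kernels. The difference telescopes: adding \<open>?Kf\<close> costs an element
    of the first kernel, adding \<open>?Kg\<close> one of the second.\<close>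
  have gen: "frag_of S - frag_of (pull F q (push F q S)) \<in> ?J" if S: "S \<in> carrier (fibre F X)" for S
  proof -
    let ?S = "S \<squnion>\<^bsub>fibre F X\<^esub> ?Kf"
    have S': "?S \<in> carrier (fibre F X)" using S Kf by (rule L.join_closed)
    have "pull F q (push F q S) = ?S \<squnion>\<^bsub>fibre F X\<^esub> ?Kg"
      using pull_push[OF q S] eq L.join_assoc[OF S Kf Kg] by simp
    moreover have "(frag_of S - frag_of ?S) \<otimes>\<^bsub>H_ob F X\<^esub> (frag_of ?S - frag_of (?S \<squnion>\<^bsub>fibre F X\<^esub> ?Kg)) \<in> ?J"
      by (rule subgroup.m_closed[OF J(3) subsetD[OF J(1) diff[OF f S]] subsetD[OF J(2) diff[OF g S']]])
    ultimately show ?thesis by (simp add: mult_H_ob)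
  qed
  show "Ker_cluster C (mod_form C F) q \<subseteq> ?J"
  proof
    fix x assume "x \<in> Ker_cluster C (mod_form C F) q"
    then have x: "Poly_Mapping.keys x \<subseteq> carrier (fibre F X)" "frag_map (push F q) x = 0"
      by (simp_all add: Ker_mod_form[OF q] H_map_eq H_ob_def)
    \<comment> \<open>\<open>frag_map_kernel\<close> is applied with \<open>push F q\<close> as
      \<open>\<phi>\<close> and \<open>pull F q\<close> as \<open>\<psi>\<close>.\<close>
    show "x \<in> ?J"
      by (rule frag_map_kernel[OF J(3)[unfolded H_ob_def] gen[unfolded H_ob_def] x, folded H_ob_def])
  qed
qed

text \<open>A support lies below a meet exactly when it lies below both clusters, so meets of images
  become intersections.\<close>

lemma Im_mod_form_meet:
  assumes f: "f \<in> Hom C X Z" and g: "g \<in> Hom C Y Z" and q: "q \<in> Hom C W Z"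
    and eq: "Im_cluster C F q = Im_cluster C F f \<sqinter>\<^bsub>fibre F Z\<^esub> Im_cluster C F g"
  shows "Im_cluster C (mod_form C F) f \<sqinter>\<^bsub>Sub (H_ob F Z)\<^esub> Im_cluster C (mod_form C F) g =
    Im_cluster C (mod_form C F) q"
proof -
  interpret M: orean_form C "mod_form C F" by (rule orean_form_mod_form)
  have Z: "Z \<in> Ob C" using Hom_Ob f by blast
  interpret L: bounded_lattice "fibre F Z" by (rule fibre_bounded_lattice[OF Z])
  have I: "Im_cluster C F f \<in> carrier (fibre F Z)" "Im_cluster C F g \<in> carrier (fibre F Z)"
    using Im_in f g by auto
  have "T \<sqsubseteq>\<^bsub>fibre F Z\<^esub> Im_cluster C F q \<longleftrightarrow>
      T \<sqsubseteq>\<^bsub>fibre F Z\<^esub> Im_cluster C F f \<and> T \<sqsubseteq>\<^bsub>fibre F Z\<^esub> Im_cluster C F g"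
    if T: "T \<in> carrier (fibre F Z)" for T
  proof
    assume le: "T \<sqsubseteq>\<^bsub>fibre F Z\<^esub> Im_cluster C F q"
    show "T \<sqsubseteq>\<^bsub>fibre F Z\<^esub> Im_cluster C F f \<and> T \<sqsubseteq>\<^bsub>fibre F Z\<^esub> Im_cluster C F g"
      using L.le_trans[OF le[unfolded eq] _ T L.meet_closed[OF I]] L.meet_left[OF I] L.meet_right[OF I] I
      by simp
  next
    assume "T \<sqsubseteq>\<^bsub>fibre F Z\<^esub> Im_cluster C F f \<and> T \<sqsubseteq>\<^bsub>fibre F Z\<^esub> Im_cluster C F g"
    then show "T \<sqsubseteq>\<^bsub>fibre F Z\<^esub> Im_cluster C F q"
      unfolding eq by (intro L.meet_le I T) simp_all
  qed
  then have "Im_cluster C (mod_form C F) q =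
      Im_cluster C (mod_form C F) f \<inter> Im_cluster C (mod_form C F) g"
    unfolding Im_mod_form_eq[OF f] Im_mod_form_eq[OF g] Im_mod_form_eq[OF q]
    by (simp add: subset_iff set_eq_iff) blast
  moreover have "subgroup (Im_cluster C (mod_form C F) f) (H_ob F Z)"
      "subgroup (Im_cluster C (mod_form C F) g) (H_ob F Z)"
    using M.Im_in[OF f] M.Im_in[OF g] by simp_all
  ultimately show ?thesis by (simp add: meet_Sub[OF group_H_ob])
qed

theorem noetherian_form_mod_form: "noetherian_form C (mod_form C F)"
proof -
  let ?M = "mod_form C F"
  interpret M: orean_form C ?M by (rule orean_form_mod_form)
  show ?thesis
  proof (intro noetherian_form.intro noetherian_form_axioms.intro orean_form_mod_form)
    fix f X Y assume f: "f \<in> Hom C X Y"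
    have dom: "Dom C f = X" using f by (simp add: Hom_def)
    show "pull ?M f (push ?M f A) = A \<squnion>\<^bsub>fibre ?M X\<^esub> Ker_cluster C ?M f"
      if "A \<in> carrier (fibre ?M X)" for A
      using vimage_image_Sub[OF H_map_group_hom[OF f] comm_group_H_ob, of A] that dom
      by (simp add: Ker_mod_form[OF f]) (simp add: H_ob_def)
    show "push ?M f (pull ?M f B) = B \<sqinter>\<^bsub>fibre ?M Y\<^esub> Im_cluster C ?M f"
      if B: "B \<in> carrier (fibre ?M Y)" for B
    proof -
      have Im: "Im_cluster C ?M f = H_map F f ` carrier (H_ob F X)"
        using M.Im_eq[OF f] by (simp add: top_Sub[OF group_H_ob])
      have "subgroup (Im_cluster C ?M f) (H_ob F Y)" using M.Im_in[OF f] by simp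
      then show ?thesis using B dom by (auto simp: meet_Sub[OF group_H_ob] Im)
    qed
    \<comment> \<open>The factorization in \<open>F\<close> serves for \<open>?M\<close> too:
      equality of kernels (images) in \<open>F\<close> transfers as two inclusions.\<close>
    obtain Z e m where em: "e \<in> quotients C F" "m \<in> embeddings C F" "e \<in> Hom C X Z" "m \<in> Hom C Z Y"
      "f = Comp C m e" "Ker_cluster C F e = Ker_cluster C F f" "Im_cluster C F m = Im_cluster C F f"
      by (rule quotient_embedding_factorization[OF f])
    have "Ker_cluster C ?M e = Ker_cluster C ?M f"
      using Ker_mod_form_le_iff[OF em(3) f] Ker_mod_form_le_iff[OF f em(3)] em(6)
        fibre_refl[OF _ Ker_in[OF f]] Hom_Ob[OF f] by auto
    moreover have "Im_cluster C ?M m = Im_cluster C ?M f"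
      using Im_mod_form_le_iff[OF em(4) f] Im_mod_form_le_iff[OF f em(4)] em(7)
        fibre_refl[OF _ Im_in[OF f]] Hom_Ob[OF f] by auto
    ultimately show "\<exists>e m. quotient_of C ?M X (Ker_cluster C ?M f) e \<and>
        embedding_of C ?M Y (Im_cluster C ?M f) m \<and> Cod C e = Dom C m \<and> f = Comp C m e"
      using em(1-5) unfolding M.quotient_of_iff M.embedding_of_iff quotients_mod_form embeddings_mod_form
      by (intro exI[of _ e] exI[of _ m]) (simp add: Hom_def)
  next
    fix X K L assume X: "X \<in> Ob C" and "normal_cluster C ?M X K" "normal_cluster C ?M X L"
    then obtain f g where fg: "f \<in> Hom C X (Cod C f)" "Ker_cluster C ?M f = K"
      "g \<in> Hom C X (Cod C g)" "Ker_cluster C ?M g = L"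
      by (auto simp: normal_cluster_def Hom_def)
    \<comment> \<open>Passing from kernels in \<open>?M\<close> to kernels of the same arrows in
      \<open>F\<close> makes (N3) for \<open>F\<close> available; the arrow \<open>q\<close>
      realizing the join there also realizes it in \<open>?M\<close>.\<close>
    have "normal_cluster C F X (Ker_cluster C F p)" if "p \<in> Hom C X (Cod C p)" for p
      using Ker_in[OF that] that by (auto simp: normal_cluster_def Hom_def)
    then have "normal_cluster C F X (Ker_cluster C F f \<squnion>\<^bsub>fibre F X\<^esub> Ker_cluster C F g)"
      using join_normal[OF X] fg by blast
    then obtain q where q: "q \<in> Hom C X (Cod C q)"
      "Ker_cluster C F q = Ker_cluster C F f \<squnion>\<^bsub>fibre F X\<^esub> Ker_cluster C F g"
      by (auto simp: normal_cluster_def Hom_def)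
    have "K \<squnion>\<^bsub>fibre ?M X\<^esub> L = Ker_cluster C ?M q"
      using Ker_mod_form_join[OF fg(1,3) q] fg by simp
    then show "normal_cluster C ?M X (K \<squnion>\<^bsub>fibre ?M X\<^esub> L)"
      using M.Ker_in[OF q(1)] q(1) unfolding normal_cluster_def Hom_def by auto
  next
    fix X S T assume X: "X \<in> Ob C" and "conormal_cluster C ?M X S" "conormal_cluster C ?M X T"
    then obtain f g where fg: "f \<in> Hom C (Dom C f) X" "Im_cluster C ?M f = S"
      "g \<in> Hom C (Dom C g) X" "Im_cluster C ?M g = T"
      by (auto simp: conormal_cluster_def Hom_def)
    \<comment> \<open>The same passage for images, with \<open>q\<close> now realizing the
      meet.\<close>
    have "conormal_cluster C F X (Im_cluster C F p)" if "p \<in> Hom C (Dom C p) X" for p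
      using Im_in[OF that] that by (auto simp: conormal_cluster_def Hom_def)
    then have "conormal_cluster C F X (Im_cluster C F f \<sqinter>\<^bsub>fibre F X\<^esub> Im_cluster C F g)"
      using meet_conormal[OF X] fg by blast
    then obtain q where q: "q \<in> Hom C (Dom C q) X"
      "Im_cluster C F q = Im_cluster C F f \<sqinter>\<^bsub>fibre F X\<^esub> Im_cluster C F g"
      by (auto simp: conormal_cluster_def Hom_def)
    have "S \<sqinter>\<^bsub>fibre ?M X\<^esub> T = Im_cluster C ?M q"
      using Im_mod_form_meet[OF fg(1,3) q] fg by simp
    then show "conormal_cluster C ?M X (S \<sqinter>\<^bsub>fibre ?M X\<^esub> T)"
      using M.Im_in[OF q(1)] q(1) unfolding conormal_cluster_def Hom_def by auto
  qed
qed

end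

theorem theorem3p23:
  fixes C :: "('o, 'm) cat" and N :: "('o, 'm, 'l) form_data"
    and \<E> \<M> :: "'m set"
  assumes "noetherian_form C N"
    and "\<E> = quotients C N" and "\<M> = embeddings C N"
  shows "Ab_functor C (H_ob N) (H_map N) \<and>
    noetherian_form C (mod_form C N) \<and>
    induces_factorization_system C (mod_form C N) \<E> \<M> \<and>
    (\<forall>X \<in> Ob C. complete_lattice (fibre (mod_form C N) X) \<and>
       algebraic_lattice (fibre (mod_form C N) X) \<and>
       modular_lattice (fibre (mod_form C N) X))"
proof -
  interpret noetherian_form C N by fact
  show ?thesis
    unfolding induces_factorization_system_def assms(2,3) mod_form_simps(1)
    by (intro conjI ballI Ab_functor_H noetherian_form_mod_form proper_factorization_system
        quotients_mod_form embeddings_mod_form complete_lattice_Sub[OF group_H_ob]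
        algebraic_lattice_Sub[OF group_H_ob] modular_lattice_Sub[OF comm_group_H_ob])
qed

end
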